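(* Let $0<p<\infty$, $0<q\le\infty$, and $0<t<\min(p,q)$. Let $\tau_{p,q}:=1/p$ if $p\le q$, and if $q<p$ let $\tau_{p,q}$ be any fixed number greater than $1/q$. Then there is a constant $C$ such that for all $y\in\mathbb{R}^n$ and all sequences $\{f_k\}_{k\in\mathbb{Z}}$ of locally integrable functions, $$\big\Vert\{\mathscr{M}^y_tf_k\}_{k\in\mathbb{Z}}\big\Vert_{L^p(\ell^q)}\le C\big(\ln(e+|y|)\big)^{\tau_{p,q}}\Vert\{f_k\}_{k\in\mathbb{Z}}\Vert_{L^p(\ell^q)}.$$
   Context: $\mathcal{D}$ is the set of dyadic cubes in $\mathbb{R}^n$, $\ell(Q)$ the side length of $Q$. For $y\in\mathbb{R}^n$ and $Q\in\mathcal{D}$ let $Q(y):=Q+\ell(Q)y$. $\mathscr{M}^yf(x):=\sup_{Q\in\mathcal{D}:x\in Q}\frac{1}{|Q|}\int_{Q(y)}|f(z)|\,dz$ and $\mathscr{M}^y_tf:=(\mathscr{M}^y(|f|^t))^{1/t}$. $\Vert\{f_k\}\Vert_{L^p(\ell^q)}:=\Vert(\sum_k|f_k|^q)^{1/q}\Vert_{L^p(\mathbb{R}^n)}$ (sup in $k$ if $q=\infty$). $C$ may depend on $n,p,q,t,\tau_{p,q}$, not on $y$. *)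

theory Defs
  imports "HOL-Analysis.Analysis"
begin

definition dlen :: "int \<Rightarrow> real" where
  "dlen j = 2 powr (- real_of_int j)"

definition dcube :: "int \<Rightarrow> int ^ 'n \<Rightarrow> (real ^ 'n) set" where
  "dcube j m = {x. \<forall>i. dlen j * real_of_int (m $ i) \<le> x $ i
                       \<and> x $ i < dlen j * (real_of_int (m $ i) + 1)}"

definition dcube_shift :: "real ^ 'n \<Rightarrow> int \<Rightarrow> int ^ 'n \<Rightarrow> (real ^ 'n) set" where
  "dcube_shift y j m = (\<lambda>z. z + dlen j *\<^sub>R y) ` dcube j m"

text \<open>Power on extended nonnegative reals (used only with positive exponent),
  with infinity ^ r = infinity.\<close>
definition epow :: "ennreal \<Rightarrow> real \<Rightarrow> ennreal" where
  "epow x r = (if x = \<infinity> then \<infinity> else ennreal (enn2real x powr r))"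

text \<open>Shifted dyadic maximal operator M^y applied to a nonnegative function g;
  |Q| = l(Q)^n.\<close>
definition shifted_max :: "real ^ 'n \<Rightarrow> (real ^ 'n \<Rightarrow> ennreal) \<Rightarrow> real ^ 'n \<Rightarrow> ennreal" where
  "shifted_max y g x =
     (SUP jm \<in> {(j, m). x \<in> dcube j m}.
        ennreal (1 / dlen (fst jm) ^ CARD('n)) *
        (\<integral>\<^sup>+ z \<in> dcube_shift y (fst jm) (snd jm). g z \<partial>lebesgue))"

definition shifted_max_t :: "real ^ 'n \<Rightarrow> real \<Rightarrow> (real ^ 'n \<Rightarrow> real) \<Rightarrow> real ^ 'n \<Rightarrow> ennreal" where
  "shifted_max_t y t f x = epow (shifted_max y (\<lambda>z. ennreal (\<bar>f z\<bar> powr t)) x) (1 / t)"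

definition lq_pt :: "ereal \<Rightarrow> (int \<Rightarrow> ennreal) \<Rightarrow> ennreal" where
  "lq_pt q a = (if q = \<infinity> then (SUP k. a k)
     else epow (SUP S \<in> {S. finite S}. \<Sum>k\<in>S. epow (a k) (real_of_ereal q))
               (1 / real_of_ereal q))"

definition LpLq_norm :: "real \<Rightarrow> ereal \<Rightarrow> (int \<Rightarrow> real ^ 'n \<Rightarrow> ennreal) \<Rightarrow> ennreal" where
  "LpLq_norm p q g = epow (\<integral>\<^sup>+ x. epow (lq_pt q (\<lambda>k. g k x)) p \<partial>lebesgue) (1 / p)"

definition locally_integrable :: "(real ^ 'n \<Rightarrow> real) \<Rightarrow> bool" where
  "locally_integrable f \<longleftrightarrow> (\<forall>K. compact K \<longrightarrow> set_integrable lebesgue K f)"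

end

theory Submission
  imports Defs
begin

text \<open>Put \<open>g\<^sub>k = \<bar>f\<^sub>k\<bar>\<^sup>t\<close>, \<open>r = p/t > 1\<close>, \<open>s = q/t > 1\<close>. Each cube \<open>Q(y)\<close> is covered by \<open>2\<^sup>n\<close> dyadic
  cubes that are translates of \<open>Q\<close> by integer multiples \<open>m\<close> of its side, where \<open>\<bar>m\<^sub>i\<bar> \<le> \<bar>y\<bar> + 1 \<le> 2\<^sup>K\<close> and
  \<open>K\<close> is comparable with \<open>ln (e + \<bar>y\<bar>)\<close>. Split the scales into the \<open>K\<close> residue classes modulo \<open>K\<close>.
  Within one class the shift by \<open>m\<close> is harmless: a cube that is strictly smaller than a stopping cube
  is moved at most to a neighbour of it. Hence each class gives a maximal operator bounded uniformly in
  \<open>y\<close>, with a weighted inequality \<open>\<integral> (T g)\<^sup>s w \<le> C \<integral> g\<^sup>s N w\<close> whose dual weight \<open>N w\<close> is a sum of operators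
  of the same kind. Summing over the classes costs a factor \<open>K\<close>, so the scalar bound in \<open>L\<^sup>r\<close> has
  the constant \<open>K\<^sup>1\<^sup>/\<^sup>r\<close>. For \<open>r \<le> s\<close> the vector-valued bound follows from the scalar one by Hoelder's
  inequality; for \<open>s < r\<close> the weighted inequality and duality give the constant \<open>K\<^sup>1\<^sup>/\<^sup>s\<close>.\<close>

subsection \<open>Powers of extended nonnegative reals\<close>

lemma epow_top [simp]: "epow top r = top"
  by (simp add: epow_def)

lemma epow_ennreal: "0 \<le> x \<Longrightarrow> epow (ennreal x) r = ennreal (x powr r)"
  by (simp add: epow_def)

lemma epow_0 [simp]: "epow 0 r = 0"
  by (simp add: epow_def)

lemma epow_one [simp]: "epow 1 r = 1"
  by (simp add: epow_def)

lemma epow_eq_0_iff [simp]: "epow x r = 0 \<longleftrightarrow> x = 0"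
  by (cases x) (auto simp: epow_ennreal ennreal_eq_0_iff)

lemma epow_eq_top_iff [simp]: "epow x r = top \<longleftrightarrow> x = top"
  by (cases x) (auto simp: epow_ennreal)

lemma epow_1 [simp]: "epow x 1 = x"
  by (cases x) (auto simp: epow_ennreal)

lemma epow_mono: "x \<le> y \<Longrightarrow> 0 \<le> r \<Longrightarrow> epow x r \<le> epow y r"
  by (cases x; cases y) (auto simp: epow_ennreal top_unique intro!: ennreal_leI powr_mono2)

lemma epow_mult: "epow (x * y) r = epow x r * epow y r"
  by (cases x; cases y)
     (auto simp: epow_ennreal powr_mult ennreal_mult_top ennreal_top_mult ennreal_eq_0_iff
           simp flip: ennreal_mult)

lemma epow_epow [simp]: "epow (epow x r) s = epow x (r * s)"
  by (cases x) (auto simp: epow_ennreal powr_powr)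

lemma epow_add: "epow x (r + s) = epow x r * epow x s"
  by (cases x) (auto simp: epow_ennreal powr_add ennreal_mult)

lemma epow_le_iff: "0 < r \<Longrightarrow> epow x r \<le> y \<longleftrightarrow> x \<le> epow y (1 / r)"
  using epow_mono[of "epow x r" y "1 / r"] epow_mono[of x "epow y (1 / r)" r] by auto

text \<open>For positive \<open>r\<close> the power is an order isomorphism of [0, top] with inverse
  the power \<open>1 / r\<close>, so it preserves arbitrary suprema, including the empty
  one.\<close>

lemma epow_SUP:
  assumes "0 < r"
  shows "epow (SUP i\<in>I. f i) r = (SUP i\<in>I. epow (f i) r)"
proof (rule antisym)
  show "epow (SUP i\<in>I. f i) r \<le> (SUP i\<in>I. epow (f i) r)"
    unfolding epow_le_iff[OF assms]
    by (intro SUP_least, subst epow_le_iff[OF assms, symmetric]) (rule SUP_upper)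
  show "(SUP i\<in>I. epow (f i) r) \<le> epow (SUP i\<in>I. f i) r"
    using assms by (intro SUP_least epow_mono SUP_upper) auto
qed

lemma borel_measurable_epow [measurable (raw)]:
  assumes [measurable]: "f \<in> borel_measurable M"
  shows "(\<lambda>x. epow (f x) r) \<in> borel_measurable M"
  unfolding epow_def by measurable

text \<open>The sum is at most \<open>card A\<close> times its largest term, and the power of that
  term occurs among the summands on the right. The argument is uniform in \<open>r\<close>, without
  convexity.\<close>

lemma epow_sum_le:
  assumes "finite A" "0 < r"
  shows "epow (\<Sum>i\<in>A. f i) r \<le> ennreal (real (card A) powr r) * (\<Sum>i\<in>A. epow (f i) r)"
proof (cases "A = {}")
  case False
  define M where "M = Max (f ` A)"
  obtain i where i: "i \<in> A" "M = f i"
    using Max_in[of "f ` A"] assms False unfolding M_def by blast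
  have "(\<Sum>i\<in>A. f i) \<le> of_nat (card A) * M"
    unfolding M_def using assms by (intro sum_bounded_above) auto
  then have "epow (\<Sum>i\<in>A. f i) r \<le> epow (ennreal (real (card A)) * M) r"
    using assms by (intro epow_mono) (auto simp: ennreal_of_nat_eq_real_of_nat)
  also have "\<dots> = ennreal (real (card A) powr r) * epow (f i) r"
    by (simp add: epow_mult epow_ennreal i)
  also have "\<dots> \<le> ennreal (real (card A) powr r) * (\<Sum>i\<in>A. epow (f i) r)"
    using i assms by (intro mult_left_mono member_le_sum) auto
  finally show ?thesis .
qed simp

section \<open>Hoelder's inequality on extended nonnegative functions\<close>

lemma epow_weighted_le_add:
  assumes "0 < \<theta>" "\<theta> < 1"
  shows "epow a \<theta> * epow b (1 - \<theta>) \<le> a + b"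
proof -
  have "epow a \<theta> * epow b (1 - \<theta>) \<le> epow (max a b) \<theta> * epow (max a b) (1 - \<theta>)"
    using assms by (intro mult_mono epow_mono) auto
  also have "\<dots> = max a b" by (simp flip: epow_add)
  also have "\<dots> \<le> a + b" by (auto simp: max_def)
  finally show ?thesis .
qed

text \<open>The constant 2 comes from replacing Young's inequality by \<open>a\<^sup>\<theta> b\<^sup>1\<^sup>-\<^sup>\<theta> \<le> a + b\<close>.\<close>

lemma nn_integral_Hoelder:
  assumes [measurable]: "u \<in> borel_measurable M" "v \<in> borel_measurable M"
    and \<theta>: "0 < \<theta>" "\<theta> < 1"
  shows "(\<integral>\<^sup>+x. epow (u x) \<theta> * epow (v x) (1 - \<theta>) \<partial>M)
    \<le> 2 * (epow (\<integral>\<^sup>+x. u x \<partial>M) \<theta> * epow (\<integral>\<^sup>+x. v x \<partial>M) (1 - \<theta>))"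
proof -
  define A B where "A = (\<integral>\<^sup>+x. u x \<partial>M)" and "B = (\<integral>\<^sup>+x. v x \<partial>M)"
  consider "A = 0" | "B = 0" | "A = top \<or> B = top" "A \<noteq> 0" "B \<noteq> 0"
    | "A \<noteq> 0" "A < top" "B \<noteq> 0" "B < top"
    using less_top by blast
  then have "(\<integral>\<^sup>+x. epow (u x) \<theta> * epow (v x) (1 - \<theta>) \<partial>M) \<le> 2 * (epow A \<theta> * epow B (1 - \<theta>))"
  proof cases
    case 1
    then have "AE x in M. u x = 0" unfolding A_def by (simp add: nn_integral_0_iff_AE)
    then have "(\<integral>\<^sup>+x. epow (u x) \<theta> * epow (v x) (1 - \<theta>) \<partial>M) = (\<integral>\<^sup>+x. 0 \<partial>M)"
      by (intro nn_integral_cong_AE) auto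
    then show ?thesis by simp
  next
    case 2
    then have "AE x in M. v x = 0" unfolding B_def by (simp add: nn_integral_0_iff_AE)
    then have "(\<integral>\<^sup>+x. epow (u x) \<theta> * epow (v x) (1 - \<theta>) \<partial>M) = (\<integral>\<^sup>+x. 0 \<partial>M)"
      by (intro nn_integral_cong_AE) auto
    then show ?thesis by simp
  next
    case 3
    then have "2 * (epow A \<theta> * epow B (1 - \<theta>)) = top"
      by (auto simp: ennreal_mult_eq_top_iff)
    then show ?thesis by simp
  next
    case 4
    \<comment> \<open>Normalisation: \<open>u / A\<close> and \<open>v / B\<close> have integral 1,
      so the pointwise bound by their sum integrates to 1 + 1.\<close>
    have *: "A * (y / A) = y" "B * (y / B) = y" for y
      using mult_divide_eq_ennreal[OF 4(1) less_imp_neq[OF 4(2)]]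
        mult_divide_eq_ennreal[OF 4(3) less_imp_neq[OF 4(4)]]
      by (simp_all add: ennreal_times_divide mult.commute[of A] mult.commute[of B])
    have "epow (u x) \<theta> * epow (v x) (1 - \<theta>)
      \<le> (epow A \<theta> * epow B (1 - \<theta>)) * (u x / A + v x / B)" for x
    proof -
      have "epow (u x) \<theta> * epow (v x) (1 - \<theta>)
        = epow (A * (u x / A)) \<theta> * epow (B * (v x / B)) (1 - \<theta>)" by (simp only: *)
      also have "\<dots> = (epow A \<theta> * epow B (1 - \<theta>)) * (epow (u x / A) \<theta> * epow (v x / B) (1 - \<theta>))"
        by (simp only: epow_mult mult_ac)
      also have "\<dots> \<le> (epow A \<theta> * epow B (1 - \<theta>)) * (u x / A + v x / B)"
        using \<theta> by (intro mult_left_mono epow_weighted_le_add) auto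
      finally show ?thesis .
    qed
    then have "(\<integral>\<^sup>+x. epow (u x) \<theta> * epow (v x) (1 - \<theta>) \<partial>M)
      \<le> (\<integral>\<^sup>+x. (epow A \<theta> * epow B (1 - \<theta>)) * (u x / A + v x / B) \<partial>M)"
      by (intro nn_integral_mono) auto
    also have "\<dots> = (epow A \<theta> * epow B (1 - \<theta>)) * (A / A + B / B)"
      by (simp add: nn_integral_cmult nn_integral_add nn_integral_divide A_def B_def)
    also have "\<dots> = 2 * (epow A \<theta> * epow B (1 - \<theta>))"
      using 4 by (simp add: mult.commute)
    finally show ?thesis .
  qed
  then show ?thesis unfolding A_def B_def .
qed

subsection \<open>Dyadic cubes\<close>

lemma dlen_pos [simp]: "0 < dlen j"
  by (simp add: dlen_def)

lemma dlen_nonneg [simp]: "0 \<le> dlen j"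
  by (simp add: dlen_def)

lemma dlen_neq_0 [simp]: "dlen j \<noteq> 0"
  by (simp add: dlen_def)

lemma dlen_add: "dlen j = 2 ^ k * dlen (j + int k)"
proof -
  have "2 ^ k = (2 :: real) powr real k" by (simp add: powr_realpow)
  then show ?thesis by (simp add: dlen_def flip: powr_add)
qed

text \<open>The cubes of scale \<open>j\<close> are the fibres of this map, which turns membership
  in a cube into an equation and lets a supremum over cubes containing \<open>x\<close> become one
  over scales.\<close>

definition dindex :: "int \<Rightarrow> real ^ 'n \<Rightarrow> int ^ 'n" where
  "dindex j x = (\<chi> i. \<lfloor>x $ i / dlen j\<rfloor>)"

lemma dindex_nth [simp]: "dindex j x $ i = \<lfloor>x $ i / dlen j\<rfloor>"
  by (simp add: dindex_def)

lemma mem_dcube_iff: "x \<in> dcube j a \<longleftrightarrow> dindex j x = a"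
proof -
  have "dlen j * real_of_int (a $ i) \<le> x $ i \<and> x $ i < dlen j * (real_of_int (a $ i) + 1)
    \<longleftrightarrow> \<lfloor>x $ i / dlen j\<rfloor> = a $ i" for i
    by (simp add: floor_eq_iff pos_le_divide_eq pos_divide_less_eq mult.commute)
  then show ?thesis by (simp add: dcube_def vec_eq_iff)
qed

text \<open>Index of the dyadic ancestor: larger \<open>j\<close> means smaller cubes, and cube
  \<open>a\<close> of scale \<open>j + k\<close> lies in cube \<open>coarsen k a\<close> of scale
  \<open>j\<close>.\<close>

definition coarsen :: "nat \<Rightarrow> int ^ 'n \<Rightarrow> int ^ 'n" where
  "coarsen k a = (\<chi> i. a $ i div 2 ^ k)"

lemma coarsen_0 [simp]: "coarsen 0 a = a"
  by (simp add: coarsen_def vec_eq_iff)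

text \<open>This is the nestedness of dyadic cubes. Integer division rounds down for negative
  numbers as well, so it commutes with the floor.\<close>

lemma dindex_coarsen: "dindex j x = coarsen k (dindex (j + int k) x)"
proof -
  have "\<lfloor>x $ i / dlen j\<rfloor> = \<lfloor>x $ i / dlen (j + int k)\<rfloor> div 2 ^ k" for i
  proof -
    have "\<lfloor>x $ i / dlen j\<rfloor> = \<lfloor>(x $ i / dlen (j + int k)) / real_of_int (2 ^ k)\<rfloor>"
      by (subst dlen_add[of j k]) (simp add: field_simps)
    also have "\<dots> = \<lfloor>x $ i / dlen (j + int k)\<rfloor> div 2 ^ k"
      by (rule floor_divide_real_eq_div) simp
    finally show ?thesis .
  qed
  then show ?thesis by (simp add: coarsen_def vec_eq_iff)
qed

lemma dindex_coarsen': "j \<le> j' \<Longrightarrow> dindex j x = coarsen (nat (j' - j)) (dindex j' x)"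
  using dindex_coarsen[of j x "nat (j' - j)"] by simp

lemma sets_dcube [measurable]: "dcube j (a :: int ^ 'n) \<in> sets borel"
proof -
  have "dcube j a = (\<Inter>i. {x. dlen j * real_of_int (a $ i) \<le> x $ i} \<inter>
      {x. x $ i < dlen j * (real_of_int (a $ i) + 1)})"
    by (auto simp: dcube_def)
  also have "\<dots> \<in> sets borel"
    by (intro sets.finite_INT sets.Int borel_closed borel_open closed_halfspace_component_ge_cart
        open_halfspace_component_lt_cart) auto
  finally show ?thesis .
qed

lemma sets_dcube_lebesgue [measurable]: "dcube j a \<in> sets lebesgue"
  using sets_dcube by auto

text \<open>The half-open cube lies between an open and a closed box of the same volume.\<close>

lemma emeasure_dcube: "emeasure lebesgue (dcube j (a :: int ^ 'n)) = ennreal (dlen j ^ CARD('n))"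
proof -
  define l u :: "real ^ 'n" where "l = (\<chi> i. dlen j * real_of_int (a $ i))"
    and "u = (\<chi> i. dlen j * (real_of_int (a $ i) + 1))"
  have le: "l $ i \<le> u $ i" for i
    unfolding l_def u_def by (simp add: mult_left_mono)
  have prod: "(\<Prod>b\<in>Basis. (u - l) \<bullet> b) = dlen j ^ CARD('n)"
  proof -
    have "(\<Prod>b\<in>Basis. (u - l) \<bullet> b) = (\<Prod>i\<in>(UNIV :: 'n set). (u - l) $ i)"
      by (subst prod.reindex_bij_betw[of "\<lambda>i. axis i 1" UNIV Basis, symmetric])
         (auto simp: bij_betw_def inj_on_def axis_eq_axis Basis_vec_def inner_axis)
    also have "\<dots> = dlen j ^ CARD('n)"
      by (simp add: l_def u_def algebra_simps)
    finally show ?thesis .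
  qed
  have le': "l \<bullet> b \<le> u \<bullet> b" if "b \<in> Basis" for b
    using that le by (auto simp: Basis_vec_def inner_axis)
  have "box l u \<subseteq> dcube j a" "dcube j a \<subseteq> cbox l u"
    by (auto simp: dcube_def l_def u_def mem_box_cart less_imp_le)
  then have "emeasure lborel (box l u) \<le> emeasure lborel (dcube j a)"
    "emeasure lborel (dcube j a) \<le> emeasure lborel (cbox l u)"
    by (auto intro!: emeasure_mono sets_dcube)
  moreover have "emeasure lborel (box l u) = dlen j ^ CARD('n)"
    "emeasure lborel (cbox l u) = dlen j ^ CARD('n)"
    using le' prod by (simp_all add: emeasure_lborel_box_eq emeasure_lborel_cbox_eq)
  ultimately show ?thesis using sets_dcube[of j a] by simp
qed

section \<open>Averages over dyadic cubes and maximal operators with integer shifts\<close>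

definition cube_avg :: "int \<Rightarrow> int ^ 'n \<Rightarrow> (real ^ 'n \<Rightarrow> ennreal) \<Rightarrow> ennreal" where
  "cube_avg j a g = ennreal (1 / dlen j ^ CARD('n)) * (\<integral>\<^sup>+ z \<in> dcube j a. g z \<partial>lebesgue)"

text \<open>With an integer shift the averages are again taken over dyadic cubes.\<close>

definition int_shifted_max :: "int set \<Rightarrow> int ^ 'n \<Rightarrow> (real ^ 'n \<Rightarrow> ennreal) \<Rightarrow> real ^ 'n \<Rightarrow> ennreal"
  where "int_shifted_max J m g x = (SUP j\<in>J. cube_avg j (dindex j x + m) g)"

lemma cube_avg_mono: "(\<And>x. g x \<le> h x) \<Longrightarrow> cube_avg j a g \<le> cube_avg j a h"
  unfolding cube_avg_def by (intro mult_left_mono nn_integral_mono mult_right_mono) auto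

lemma cube_avg_const: "cube_avg j (a :: int ^ 'n) (\<lambda>_. c) = c"
proof -
  have "cube_avg j a (\<lambda>_ :: real ^ 'n. c)
    = (ennreal (1 / dlen j ^ CARD('n)) * ennreal (dlen j ^ CARD('n))) * c"
    by (simp add: cube_avg_def nn_integral_cmult_indicator emeasure_dcube mult_ac)
  then show ?thesis by (simp flip: ennreal_mult)
qed

lemma cube_avg_add:
  assumes [measurable]: "g \<in> borel_measurable lebesgue" "h \<in> borel_measurable lebesgue"
  shows "cube_avg j a (\<lambda>x. g x + h x) = cube_avg j a g + cube_avg j a h"
  by (simp add: cube_avg_def distrib_right distrib_left nn_integral_add)

lemma set_nn_integral_cube:
  "(\<integral>\<^sup>+ z \<in> dcube j (a :: int ^ 'n). g z \<partial>lebesgue) = ennreal (dlen j ^ CARD('n)) * cube_avg j a g"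
  by (simp add: cube_avg_def mult.assoc[symmetric] flip: ennreal_mult)

text \<open>There are only countably many indices, and the fibres are cubes. Hence every function of
  the index is measurable, and the maximal functions below are measurable for arbitrary
  \<open>g\<close>.\<close>

lemma dindex_measurable [measurable]: "dindex j \<in> measurable lebesgue (count_space UNIV)"
  unfolding measurable_count_space_eq_countable[OF countable_subset[OF subset_UNIV countableI_type]]
proof safe
  fix a :: "int ^ 'n"
  have "dindex j -` {a} \<inter> space lebesgue = dcube j a"
    by (auto simp: mem_dcube_iff)
  then show "dindex j -` {a} \<inter> space lebesgue \<in> sets lebesgue"
    by simp
qed auto

subsection \<open>The weighted weak-type inequality\<close>

text \<open>Translations from a cube to itself or to one of its 3^n - 1 neighbours.\<close>

definition unit_shifts :: "(int ^ 'n) set" where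
  "unit_shifts = {e. \<forall>i. e $ i \<in> {-1..1}}"

lemma finite_vec_range: "finite {e :: int ^ 'n. \<forall>i. e $ i \<in> A}" if "finite A"
proof -
  have "{e :: int ^ 'n. \<forall>i. e $ i \<in> A} \<subseteq> vec_lambda ` (UNIV \<rightarrow>\<^sub>E A)"
    by (force simp: image_iff PiE_def intro!: exI[of _ "vec_nth _"] bexI[of _ "vec_nth _"])
  moreover have "finite (vec_lambda ` ((UNIV :: 'n set) \<rightarrow>\<^sub>E A))"
    using that by (intro finite_imageI finite_PiE) auto
  ultimately show ?thesis by (rule finite_subset)
qed

lemma finite_unit_shifts [simp]: "finite unit_shifts"
  unfolding unit_shifts_def by (rule finite_vec_range) simp

text \<open>Adding or subtracting \<open>b\<close> changes the quotient by exactly 1, and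
  \<open>a + m\<close> lies between these two extremes.\<close>

lemma div_shift_bounds:
  fixes a m b :: int
  assumes "0 < b" "\<bar>m\<bar> \<le> b"
  shows "a div b - (a + m) div b \<in> {-1..1}"
proof -
  have "(a + m) div b \<le> (a + b) div b" "(a - b) div b \<le> (a + m) div b"
    using assms by (intro zdiv_mono1; linarith)+
  moreover have "(a + b) div b = a div b + 1" "(a - b) div b = a div b - 1"
    using assms div_add_self2[of b a] div_add_self2[of b "a - b"] by auto
  ultimately show ?thesis unfolding atLeastAtMost_iff by linarith
qed

text \<open>The geometric core: a translation by at most 2^k side lengths moves the ancestor
  \<open>k\<close> generations up to itself or to a neighbour only.\<close>

lemma coarsen_shift:
  assumes "\<And>i. \<bar>m $ i\<bar> \<le> 2 ^ k"
  shows "coarsen k a - coarsen k (a + m) \<in> unit_shifts"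
  using div_shift_bounds[OF _ assms] by (simp add: unit_shifts_def coarsen_def)

text \<open>Sides of different scales in \<open>J\<close> differ by a factor of at least 2^K, which
  is what \<open>coarsen_shift\<close> requires to absorb a shift with coordinates up to
  2^K.\<close>

definition lacunary :: "nat \<Rightarrow> int set \<Rightarrow> bool" where
  "lacunary K J \<longleftrightarrow> (\<forall>j\<in>J. \<forall>j'\<in>J. j < j' \<longrightarrow> int K \<le> j' - j)"

lemma int_shifted_max_measurable [measurable]:
  "int_shifted_max J m g \<in> borel_measurable lebesgue"
proof -
  have "(\<lambda>x. cube_avg j (dindex j x + m) g) \<in> borel_measurable lebesgue" for j
    by (rule measurable_compose[OF dindex_measurable]) simp
  then show ?thesis
    unfolding int_shifted_max_def[abs_def] by (intro borel_measurable_SUP) auto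
qed

text \<open>Translates of a stopping cube that cover the level set: \<open>- m\<close> undoes the
  shift for cubes of the same size, and the unit shifts serve the smaller ones. Their number is
  bounded independently of \<open>m\<close>.\<close>

definition dual_shifts :: "int ^ 'n \<Rightarrow> (int ^ 'n) set" where
  "dual_shifts m = insert (- m) unit_shifts"

lemma finite_dual_shifts [simp]: "finite (dual_shifts m)"
  by (simp add: dual_shifts_def)

text \<open>The cubes on which the average of \<open>g\<close> exceeds the level are contained in disjoint maximal
  ones \<open>P\<close>. If \<open>Q + m \<ell>(Q)\<close> lies in \<open>P\<close>, then \<open>Q\<close> is \<open>P - m \<ell>(P)\<close> when \<open>Q\<close> has the size of \<open>P\<close>;
  otherwise the lacunarity of the scales makes \<open>Q\<close> so small that it lies in \<open>P\<close> or a neighbour of \<open>P\<close>.\<close>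

lemma weak_type_bounded_below:
  fixes g w :: "real ^ 'n \<Rightarrow> ennreal" and m :: "int ^ 'n"
  assumes J: "J \<subseteq> {j0..}" "lacunary K J" and m: "\<And>i. \<bar>m $ i\<bar> \<le> 2 ^ K"
    and [measurable]: "g \<in> borel_measurable lebesgue" "w \<in> borel_measurable lebesgue"
  shows "\<alpha> * (\<integral>\<^sup>+x. indicator {x. \<alpha> < int_shifted_max J m g x} x * w x \<partial>lebesgue)
    \<le> (\<Sum>d\<in>dual_shifts m. \<integral>\<^sup>+x. g x * int_shifted_max J d w x \<partial>lebesgue)"
proof -
  \<comment> \<open>Since smaller \<open>j'\<close> means a larger cube, the last condition is
    maximality under inclusion among the scales of \<open>J\<close>.\<close>
  define \<P> where "\<P> = {(j, a). j \<in> J \<and> \<alpha> < cube_avg j a g \<and>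
    (\<forall>j'\<in>J. j' < j \<longrightarrow> cube_avg j' (coarsen (nat (j - j')) a) g \<le> \<alpha>)}"
  let ?D = "dual_shifts m"
  let ?c = "\<lambda>P d. dcube (fst P) (snd P + d :: int ^ 'n)"

  have cover: "\<exists>P\<in>\<P>. \<exists>d\<in>?D. x \<in> ?c P d" if x: "\<alpha> < int_shifted_max J m g x" for x
  proof -
    obtain j where j: "j \<in> J" "\<alpha> < cube_avg j (dindex j x + m) g"
      using x unfolding int_shifted_max_def less_SUP_iff by blast
    define a where "a = dindex j x + m"
    \<comment> \<open>The ancestors of \<open>a\<close> with large average are numbered by their
      distance to \<open>j0\<close>. The lower bound on the scales makes this a natural number that
      determines the scale, so the least one gives the largest such cube.\<close>
    define Q where "Q n \<longleftrightarrow> (\<exists>j'\<in>J. j' \<le> j \<and> n = nat (j' - j0) \<and> \<alpha> < cube_avg j' (coarsen (nat (j - j')) a) g)" for n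
    have "Q (nat (j - j0))" unfolding Q_def using j by (intro bexI[of _ j]) (auto simp: a_def)
    then have "Q (Least Q)" by (rule LeastI)
    then obtain j' where j': "j' \<in> J" "j' \<le> j" "Least Q = nat (j' - j0)"
      "\<alpha> < cube_avg j' (coarsen (nat (j - j')) a) g"
      unfolding Q_def by blast
    define b where "b = coarsen (nat (j - j')) a"
    have "(j', b) \<in> \<P>"
    proof -
      have "cube_avg i (coarsen (nat (j' - i)) b) g \<le> \<alpha>" if i: "i \<in> J" "i < j'" for i
      proof (rule ccontr)
        assume "\<not> ?thesis"
        moreover have "coarsen (nat (j' - i)) b = coarsen (nat (j - i)) a"
        proof -
          have "nat (j - i) = nat (j - j') + nat (j' - i)" using i j' by auto
          then show ?thesis
            by (simp add: b_def coarsen_def vec_eq_iff power_add zdiv_zmult2_eq)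
        qed
        ultimately have "Q (nat (i - j0))"
          unfolding Q_def using i j' by (intro bexI[of _ i]) auto
        then have "Least Q \<le> nat (i - j0)" by (rule Least_le)
        moreover have "j0 \<le> i" "j0 \<le> j'" using J(1) i j' by auto
        ultimately show False using j'(3) i by auto
      qed
      then show ?thesis unfolding \<P>_def using j' by (auto simp: b_def)
    qed
    moreover have "\<exists>d\<in>?D. dindex j' x = b + d"
    proof (cases "j' = j")
      case True
      then have "dindex j' x = b + (- m)" by (simp add: b_def a_def)
      then show ?thesis unfolding dual_shifts_def by blast
    next
      case False
      then have "int K \<le> j - j'" using j j' J(2) unfolding lacunary_def by force
      then have "(2 :: int) ^ K \<le> 2 ^ nat (j - j')" by (intro power_increasing) auto
      then have "\<bar>m $ i\<bar> \<le> 2 ^ nat (j - j')" for i using m[of i] by linarith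
      from coarsen_shift[OF this, of "dindex j x"]
      have "dindex j' x - b \<in> unit_shifts"
        using j' by (simp add: dindex_coarsen'[of j' j x] b_def a_def)
      then show ?thesis by (intro bexI[of _ "dindex j' x - b"]) (auto simp: dual_shifts_def)
    qed
    ultimately show ?thesis by (auto simp: mem_dcube_iff intro!: bexI[of _ "(j', b)"])
  qed

  \<comment> \<open>Two stopping cubes that contain \<open>x\<close> are nested, and the smaller one
    would violate maximality. The sum over cubes is written as a counting-measure integral so that
    Tonelli applies.\<close>
  have disjoint: "(\<integral>\<^sup>+P. indicator \<P> P * indicator (?c P 0) x \<partial>count_space UNIV) \<le> (1 :: ennreal)" for x
  proof -
    define S where "S = {P \<in> \<P>. x \<in> ?c P 0}"
    have uniq: "P = P'" if P: "P \<in> S" "P' \<in> S" "fst P \<le> fst P'" for P P'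
    proof -
      obtain j a j' a' where [simp]: "P = (j, a)" "P' = (j', a')" by (cases P, cases P')
      have a: "a = dindex j x" "a' = dindex j' x" "(j, a) \<in> \<P>" "(j', a') \<in> \<P>"
        using P by (auto simp: S_def mem_dcube_iff)
      show ?thesis
      proof (cases "j = j'")
        case False
        then have "j < j'" using P by simp
        then show ?thesis using a dindex_coarsen'[of j j' x] by (auto simp: \<P>_def)
      qed (use a in simp)
    qed
    have "card S \<le> 1 \<and> finite S"
    proof (cases "S = {}")
      case False
      then obtain P where P: "P \<in> S" by blast
      have "S = {P}" using uniq P by (metis insertI1 is_singletonI' is_singleton_def linorder_linear singletonD False)
      then show ?thesis by simp
    qed simp
    moreover have "(\<integral>\<^sup>+P. indicator \<P> P * indicator (?c P 0) x \<partial>count_space UNIV)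
      = (\<integral>\<^sup>+P. (indicator S P :: ennreal) \<partial>count_space UNIV)"
      by (intro nn_integral_cong) (auto simp: S_def indicator_def)
    ultimately show ?thesis by (simp add: emeasure_count_space)
  qed

  have "\<alpha> * (\<integral>\<^sup>+x. indicator {x. \<alpha> < int_shifted_max J m g x} x * w x \<partial>lebesgue)
    \<le> \<alpha> * (\<integral>\<^sup>+x. (\<integral>\<^sup>+P. (\<Sum>d\<in>?D. indicator \<P> P * (w x * indicator (?c P d) x)) \<partial>count_space UNIV) \<partial>lebesgue)"
  proof (intro mult_left_mono nn_integral_mono)
    fix x :: "real ^ 'n"
    show "indicator {x. \<alpha> < int_shifted_max J m g x} x * w x
      \<le> (\<integral>\<^sup>+P. (\<Sum>d\<in>?D. indicator \<P> P * (w x * indicator (?c P d) x)) \<partial>count_space UNIV)"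
    proof (cases "\<alpha> < int_shifted_max J m g x")
      case True
      then obtain P d where P: "P \<in> \<P>" "d \<in> ?D" "x \<in> ?c P d" using cover by blast
      have "w x = indicator \<P> P * (w x * indicator (?c P d) x)" using P by simp
      also have "\<dots> \<le> (\<Sum>d\<in>?D. indicator \<P> P * (w x * indicator (?c P d) x))"
        using P by (intro member_le_sum) auto
      also have "\<dots> \<le> (\<integral>\<^sup>+P. (\<Sum>d\<in>?D. indicator \<P> P * (w x * indicator (?c P d) x)) \<partial>count_space UNIV)"
        by (rule nn_integral_ge_point) simp
      finally show ?thesis using True by simp
    qed simp
  qed auto
  also have "\<dots> = (\<integral>\<^sup>+P. (\<Sum>d\<in>?D. \<alpha> * (indicator \<P> P * (ennreal (dlen (fst P) ^ CARD('n)) * cube_avg (fst P) (snd P + d) w)))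
      \<partial>count_space UNIV)"
  proof -
    have "(\<integral>\<^sup>+x. (\<Sum>d\<in>?D. indicator \<P> P * (w x * indicator (?c P d) x)) \<partial>lebesgue)
      = (\<Sum>d\<in>?D. indicator \<P> P * (ennreal (dlen (fst P) ^ CARD('n)) * cube_avg (fst P) (snd P + d) w))" for P
      by (subst nn_integral_sum) (simp_all add: nn_integral_cmult set_nn_integral_cube del: sum_mult_indicator)
    moreover have "(\<integral>\<^sup>+x. (\<integral>\<^sup>+P. (\<Sum>d\<in>?D. indicator \<P> P * (w x * indicator (?c P d) x)) \<partial>count_space UNIV) \<partial>lebesgue)
      = (\<integral>\<^sup>+P. (\<integral>\<^sup>+x. (\<Sum>d\<in>?D. indicator \<P> P * (w x * indicator (?c P d) x)) \<partial>lebesgue) \<partial>count_space UNIV)"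
      by (rule nn_integral_count_space_nn_integral) (simp, measurable)
    ultimately show ?thesis
      by (simp only: nn_integral_cmult borel_measurable_count_space sum_distrib_left[symmetric])
  qed
  \<comment> \<open>On a stopping cube P the level is below the average of \<open>g\<close>, so
    \<alpha> |P| is at most the integral of \<open>g\<close> over P. The remaining factor, the
    average of \<open>w\<close> over the translate of P by \<open>d\<close>, is at most
    \<open>int_shifted_max J d w\<close> at every point of P.\<close>
  also have "\<dots> \<le> (\<integral>\<^sup>+P. (\<Sum>d\<in>?D. \<integral>\<^sup>+x. (indicator \<P> P * indicator (?c P 0) x) * (g x * int_shifted_max J d w x) \<partial>lebesgue)
      \<partial>count_space UNIV)"
  proof (intro nn_integral_mono sum_mono)
    fix P :: "int \<times> (int ^ 'n)" and d :: "int ^ 'n"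
    obtain j a where P: "P = (j, a)" by (cases P)
    show "\<alpha> * (indicator \<P> P * (ennreal (dlen (fst P) ^ CARD('n)) * cube_avg (fst P) (snd P + d) w))
      \<le> (\<integral>\<^sup>+x. (indicator \<P> P * indicator (?c P 0) x) * (g x * int_shifted_max J d w x) \<partial>lebesgue)"
    proof (cases "P \<in> \<P>")
      case True
      then have j: "j \<in> J" "\<alpha> \<le> cube_avg j a g" by (auto simp: \<P>_def P)
      have "\<alpha> * (ennreal (dlen j ^ CARD('n)) * cube_avg j (a + d) w)
        \<le> cube_avg j a g * (ennreal (dlen j ^ CARD('n)) * cube_avg j (a + d) w)"
        using j by (intro mult_right_mono) auto
      also have "\<dots> = (\<integral>\<^sup>+x\<in>dcube j a. g x \<partial>lebesgue) * cube_avg j (a + d) w"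
        by (simp add: set_nn_integral_cube mult_ac)
      also have "\<dots> = (\<integral>\<^sup>+x. g x * indicator (dcube j a) x * cube_avg j (a + d) w \<partial>lebesgue)"
        by (simp add: nn_integral_multc)
      also have "\<dots> \<le> (\<integral>\<^sup>+x. indicator (dcube j a) x * (g x * int_shifted_max J d w x) \<partial>lebesgue)"
      proof (intro nn_integral_mono)
        fix x :: "real ^ 'n"
        have "cube_avg j (a + d) w \<le> int_shifted_max J d w x" if "x \<in> dcube j a"
          using that j unfolding int_shifted_max_def mem_dcube_iff by (auto intro!: SUP_upper2[of j])
        then show "g x * indicator (dcube j a) x * cube_avg j (a + d) w
          \<le> indicator (dcube j a) x * (g x * int_shifted_max J d w x)"
          by (auto simp: indicator_def intro: mult_left_mono)
      qed
      finally show ?thesis using True by (simp add: P)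
    qed simp
  qed
  also have "\<dots> = (\<integral>\<^sup>+x. (\<integral>\<^sup>+P. (\<Sum>d\<in>?D. (indicator \<P> P * indicator (?c P 0) x) * (g x * int_shifted_max J d w x)) \<partial>count_space UNIV) \<partial>lebesgue)"
    by (subst nn_integral_count_space_nn_integral) (auto simp: nn_integral_sum)
  also have "\<dots> = (\<integral>\<^sup>+x. (\<integral>\<^sup>+P. indicator \<P> P * indicator (?c P 0) x \<partial>count_space UNIV)
      * (\<Sum>d\<in>?D. g x * int_shifted_max J d w x) \<partial>lebesgue)"
    by (simp add: nn_integral_multc flip: sum_distrib_left)
  also have "\<dots> \<le> (\<integral>\<^sup>+x. 1 * (\<Sum>d\<in>?D. g x * int_shifted_max J d w x) \<partial>lebesgue)"
    by (intro nn_integral_mono mult_right_mono disjoint) auto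
  also have "\<dots> = (\<Sum>d\<in>?D. \<integral>\<^sup>+x. g x * int_shifted_max J d w x \<partial>lebesgue)"
    by (simp add: nn_integral_sum)
  finally show ?thesis .
qed

subsection \<open>The weighted strong-type inequality\<close>

text \<open>A dyadic layer-cake bound: for finite positive \<open>y\<close> the single term with 2^i
  < y <= 2^(i+1) already dominates. The sum over all integers is a counting-measure
  integral.\<close>

lemma epow_le_sum_levels:
  assumes "0 < s"
  shows "epow y s \<le> (\<integral>\<^sup>+i. ennreal (2 powr ((of_int i + 1) * s)) * indicator {i. ennreal (2 powr of_int i) < y} i
    \<partial>count_space (UNIV :: int set))" (is "_ \<le> ?R y")
proof -
  have le_R: "ennreal (r powr s) \<le> ?R y" if r: "0 < r" "ennreal r \<le> y" for r
  proof -
    \<comment> \<open>Ceiling minus 1, not the floor, so that the lower bound 2^i < r is strict even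
      when \<open>r\<close> is a power of two.\<close>
    define i where "i = \<lceil>log 2 r\<rceil> - 1"
    have "of_int i < log 2 r" "log 2 r \<le> of_int i + 1" unfolding i_def by linarith+
    then have i: "2 powr of_int i < r" "r \<le> 2 powr (of_int i + 1)"
      using r by (simp_all add: less_log_iff log_le_iff)
    have "ennreal (2 powr of_int i) < y"
      using i r by (metis ennreal_lessI order_less_le_trans)
    moreover have "r powr s \<le> 2 powr ((of_int i + 1) * s)"
      using powr_mono2[OF _ _ i(2), of s] r assms by (simp add: powr_powr)
    ultimately have "ennreal (r powr s) \<le> ennreal (2 powr ((of_int i + 1) * s)) * indicator {i. ennreal (2 powr of_int i) < y} i"
      by (simp add: ennreal_leI)
    also have "\<dots> \<le> ?R y" by (rule nn_integral_ge_point) simp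
    finally show ?thesis .
  qed
  show ?thesis
  proof (cases y)
    case (real r)
    then show ?thesis using le_R[of r] by (cases "r = 0") (auto simp: epow_ennreal)
  next
    case top
    have "?R y = top"
    proof (rule ccontr)
      assume "?R y \<noteq> top"
      then obtain c where c: "0 \<le> c" "?R y = ennreal c" by (cases "?R y") auto
      \<comment> \<open>For infinite \<open>y\<close> every finite \<open>r\<close> is admissible;
        this one satisfies r^s = c + 1, which exceeds the supposed value \<open>c\<close> of the
        sum.\<close>
      have "ennreal (((c + 1) powr (1 / s)) powr s) \<le> ?R y"
        using c by (intro le_R) (auto simp: top)
      then show False unfolding c using c assms by (simp add: powr_powr)
    qed
    then show ?thesis by simp
  qed
qed

lemma nn_integral_geometric_int:
  assumes "0 < b"
  shows "(\<integral>\<^sup>+i. ennreal (2 powr (of_int i * b)) * indicator {..i0} i \<partial>count_space (UNIV :: int set))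
    = ennreal (2 powr (of_int i0 * b) / (1 - 2 powr - b))"
proof -
  have bij: "bij_betw (\<lambda>k. i0 - int k) UNIV {..i0}"
    by (rule bij_betwI[of _ _ _ "\<lambda>i. nat (i0 - i)"]) auto
  have "(\<integral>\<^sup>+i. ennreal (2 powr (of_int i * b)) * indicator {..i0} i \<partial>count_space UNIV)
    = (\<integral>\<^sup>+i. ennreal (2 powr (of_int i * b)) \<partial>count_space {..i0})"
    by (simp add: nn_integral_count_space_indicator)
  also have "\<dots> = (\<integral>\<^sup>+k. ennreal (2 powr (of_int (i0 - int k) * b)) \<partial>count_space UNIV)"
    by (rule nn_integral_bij_count_space[OF bij, symmetric])
  also have "\<dots> = (\<Sum>k. ennreal (2 powr (of_int i0 * b) * (2 powr - b) ^ k))"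
    by (simp add: nn_integral_count_space_nat powr_realpow[symmetric] powr_powr algebra_simps
        flip: powr_add)
  also have "\<dots> = ennreal (2 powr (of_int i0 * b) * (1 / (1 - 2 powr - b)))"
  proof (rule suminf_ennreal_eq)
    have "2 powr - b < 2 powr 0" using assms by (intro powr_less_mono) auto
    then show "(\<lambda>k. 2 powr (of_int i0 * b) * (2 powr - b) ^ k) sums (2 powr (of_int i0 * b) * (1 / (1 - 2 powr - b)))"
      by (intro sums_mult geometric_sums) simp
  qed auto
  finally show ?thesis by simp
qed

text \<open>The denominator comes from a geometric series of ratio 2^(1-s), convergent for s > 1.
  The numerator is 2^(s+1) from the level weights times 2^(s-1) from rounding \<open>y\<close> up to
  a power of two.\<close>

definition strong_const :: "real \<Rightarrow> real" where
  "strong_const s = 2 powr (2 * s) / (1 - 2 powr (1 - s))"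

lemma strong_const_pos: "1 < s \<Longrightarrow> 0 < strong_const s"
  using powr_less_mono[of "1 - s" 0 2] by (simp add: strong_const_def)

text \<open>The terms vanish once 2^(i-1) >= y and before that grow geometrically with ratio 2^(s-1)
  > 1, so for finite positive \<open>y\<close> the sum is comparable with its last nonzero term. The
  exponent joins (i+1)s from the layer-cake bound with -(i-1) from the weak-type inequality.\<close>

lemma sum_levels_le_epow:
  assumes s: "1 < s"
  shows "(\<integral>\<^sup>+i. ennreal (2 powr ((of_int i + 1) * s - (of_int i - 1))) *
      (indicator {i. ennreal (2 powr (of_int i - 1)) < y} i * y) \<partial>count_space (UNIV :: int set))
    \<le> ennreal (strong_const s) * epow y s"
proof (cases "y = 0 \<or> y = top")
  case True
  then show ?thesis using strong_const_pos[OF s] by (auto simp: ennreal_mult_top)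
next
  case False
  then obtain r where r: "0 < r" "y = ennreal r" by (cases y) (auto simp: less_le)
  \<comment> \<open>With the ceiling, 2^(i-1) < r holds exactly for i <= i0.\<close>
  define i0 where "i0 = \<lceil>log 2 r\<rceil>"
  have iff: "ennreal (2 powr (of_int i - 1)) < y \<longleftrightarrow> i \<le> i0" for i
  proof -
    have "ennreal (2 powr (of_int i - 1)) < y \<longleftrightarrow> of_int i - 1 < log 2 r"
      using r by (simp add: ennreal_less_iff less_log_iff)
    also have "\<dots> \<longleftrightarrow> i \<le> i0" unfolding i0_def by linarith
    finally show ?thesis .
  qed
  have "of_int i0 \<le> log 2 r + 1" unfolding i0_def by linarith
  then have "2 powr of_int i0 \<le> 2 powr (log 2 r + 1)" by simp
  then have i0: "2 powr of_int i0 \<le> 2 * r" using r by (simp add: powr_add)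
  have pos: "0 < 1 - 2 powr (1 - s)" using s powr_less_mono[of "1 - s" 0 2] by simp
  have "(\<integral>\<^sup>+i. ennreal (2 powr ((of_int i + 1) * s - (of_int i - 1))) *
      (indicator {i. ennreal (2 powr (of_int i - 1)) < y} i * y) \<partial>count_space (UNIV :: int set))
    = (\<integral>\<^sup>+i. ennreal (2 powr (s + 1) * r) * (ennreal (2 powr (of_int i * (s - 1))) * indicator {..i0} i) \<partial>count_space UNIV)"
  proof (intro nn_integral_cong)
    fix i :: int
    have "2 powr ((of_int i + 1) * s - (of_int i - 1)) = 2 powr (s + 1) * 2 powr (of_int i * (s - 1))"
      by (simp add: algebra_simps flip: powr_add)
    then show "ennreal (2 powr ((of_int i + 1) * s - (of_int i - 1))) *
      (indicator {i. ennreal (2 powr (of_int i - 1)) < y} i * y)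
      = ennreal (2 powr (s + 1) * r) * (ennreal (2 powr (of_int i * (s - 1))) * indicator {..i0} i)"
      using r iff[of i] by (cases "i \<le> i0") (simp_all add: ennreal_mult mult_ac)
  qed
  also have "\<dots> = ennreal (2 powr (s + 1) * r) * ennreal (2 powr (of_int i0 * (s - 1)) / (1 - 2 powr - (s - 1)))"
    using s by (simp add: nn_integral_cmult nn_integral_geometric_int del: minus_diff_eq)
  also have "\<dots> = ennreal ((2 powr (s + 1) * r) * ((2 powr of_int i0) powr (s - 1) / (1 - 2 powr (1 - s))))"
    using r pos by (subst ennreal_mult[symmetric]) (simp_all add: powr_powr)
  also have "\<dots> \<le> ennreal ((2 powr (s + 1) * r) * ((2 * r) powr (s - 1) / (1 - 2 powr (1 - s))))"
    using r pos s i0 by (intro ennreal_leI mult_left_mono divide_right_mono powr_mono2) auto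
  also have "(2 powr (s + 1) * r) * ((2 * r) powr (s - 1) / (1 - 2 powr (1 - s))) = strong_const s * r powr s"
  proof -
    have "(2 powr (s + 1) * r) * (2 * r) powr (s - 1) = (2 powr (s + 1) * 2 powr (s - 1)) * (r powr 1 * r powr (s - 1))"
      using r by (simp add: powr_mult)
    also have "\<dots> = 2 powr (2 * s) * r powr s"
      unfolding powr_add[symmetric] by simp
    finally show ?thesis by (simp add: strong_const_def)
  qed
  finally show ?thesis using r s strong_const_pos[OF s] by (simp add: epow_ennreal ennreal_mult)
qed

text \<open>The part of \<open>g\<close> not exceeding \<open>b\<close> has averages at most
  \<open>b\<close>. This is the trivial endpoint of the interpolation that follows.\<close>

lemma int_shifted_max_le_add_const:
  assumes [measurable]: "g \<in> borel_measurable lebesgue"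
  shows "int_shifted_max J m g x \<le> int_shifted_max J m (\<lambda>x. indicator {x. b < g x} x * g x) x + b"
  unfolding int_shifted_max_def
proof (rule SUP_least)
  fix j assume "j \<in> J"
  have "cube_avg j (dindex j x + m) g
    \<le> cube_avg j (dindex j x + m) (\<lambda>x. indicator {x. b < g x} x * g x + b)"
    by (rule cube_avg_mono) (auto simp: indicator_def not_less)
  also have "\<dots> = cube_avg j (dindex j x + m) (\<lambda>x. indicator {x. b < g x} x * g x) + b"
    by (simp add: cube_avg_add cube_avg_const)
  also have "\<dots> \<le> (SUP j\<in>J. cube_avg j (dindex j x + m) (\<lambda>x. indicator {x. b < g x} x * g x)) + b"
    using \<open>j \<in> J\<close> by (intro add_right_mono SUP_upper)
  finally show "cube_avg j (dindex j x + m) g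
    \<le> (SUP j\<in>J. cube_avg j (dindex j x + m) (\<lambda>x. indicator {x. b < g x} x * g x)) + b" .
qed

text \<open>Marcinkiewicz interpolation between the weak-type inequality and the trivial bound for
  bounded functions: where the maximal function exceeds 2^i, that of the part of \<open>g\<close>
  above 2^(i-1) exceeds 2^(i-1). The weak-type inequality is applied at this halved level and the
  levels are summed.\<close>

lemma strong_type_bounded_below:
  fixes g w :: "real ^ 'n \<Rightarrow> ennreal" and m :: "int ^ 'n"
  assumes J: "J \<subseteq> {j0..}" "lacunary K J" and m: "\<And>i. \<bar>m $ i\<bar> \<le> 2 ^ K" and s: "1 < s"
    and [measurable]: "g \<in> borel_measurable lebesgue" "w \<in> borel_measurable lebesgue"
  shows "(\<integral>\<^sup>+x. epow (int_shifted_max J m g x) s * w x \<partial>lebesgue)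
    \<le> ennreal (strong_const s) * (\<Sum>d\<in>dual_shifts m. \<integral>\<^sup>+x. epow (g x) s * int_shifted_max J d w x \<partial>lebesgue)"
proof -
  let ?D = "dual_shifts m"
  \<comment> \<open>\<open>c\<close> are the layer-cake weights, \<open>c'\<close> the weights left
    after the weak-type inequality at height 2^(i-1), and \<open>cut i\<close> keeps the values
    above that height.\<close>
  define c where "c i = ennreal (2 powr ((of_int i + 1) * s))" for i :: int
  define c' where "c' i = ennreal (2 powr ((of_int i + 1) * s - (of_int i - 1)))" for i :: int
  define cut where "cut i y = indicator {i. ennreal (2 powr (of_int i - 1)) < y} i * y" for i :: int and y :: ennreal
  have [measurable]: "(\<lambda>x. cut i (g x)) \<in> borel_measurable lebesgue" for i
    unfolding cut_def by measurable
  have level: "(\<integral>\<^sup>+x. indicator {x. ennreal (2 powr of_int i) < int_shifted_max J m g x} x * w x \<partial>lebesgue)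
    \<le> ennreal (2 powr - (of_int i - 1)) * (\<Sum>d\<in>?D. \<integral>\<^sup>+x. cut i (g x) * int_shifted_max J d w x \<partial>lebesgue)" for i :: int
  proof -
    let ?b = "ennreal (2 powr (of_int i - 1))"
    have b2: "ennreal (2 powr of_int i) = ?b + ?b"
    proof -
      have "2 powr real_of_int i = 2 powr (of_int i - 1) * 2 powr 1"
        using powr_add[of "2 :: real" "of_int i - 1" 1] by simp
      then show ?thesis by (simp flip: ennreal_plus)
    qed
    have "(\<integral>\<^sup>+x. indicator {x. ennreal (2 powr of_int i) < int_shifted_max J m g x} x * w x \<partial>lebesgue)
      \<le> (\<integral>\<^sup>+x. indicator {x. ?b < int_shifted_max J m (\<lambda>x. cut i (g x)) x} x * w x \<partial>lebesgue)"
    proof (intro nn_integral_mono)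
      fix x :: "real ^ 'n"
      have "?b < int_shifted_max J m (\<lambda>x. cut i (g x)) x" if "ennreal (2 powr of_int i) < int_shifted_max J m g x"
      proof -
        have "?b + ?b < int_shifted_max J m (\<lambda>x. cut i (g x)) x + ?b"
          using order_less_le_trans[OF that[unfolded b2] int_shifted_max_le_add_const[of g J m x ?b]]
          by (simp add: cut_def indicator_def)
        then show ?thesis by (meson add_right_mono not_le)
      qed
      then show "indicator {x. ennreal (2 powr of_int i) < int_shifted_max J m g x} x * w x
        \<le> indicator {x. ?b < int_shifted_max J m (\<lambda>x. cut i (g x)) x} x * w x"
        by (auto simp: indicator_def)
    qed
    also have "\<dots> = ennreal (2 powr - (of_int i - 1)) *
      (?b * (\<integral>\<^sup>+x. indicator {x. ?b < int_shifted_max J m (\<lambda>x. cut i (g x)) x} x * w x \<partial>lebesgue))"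
      by (simp add: mult.assoc[symmetric] flip: ennreal_mult powr_add)
    also have "\<dots> \<le> ennreal (2 powr - (of_int i - 1)) * (\<Sum>d\<in>?D. \<integral>\<^sup>+x. cut i (g x) * int_shifted_max J d w x \<partial>lebesgue)"
      by (intro mult_left_mono weak_type_bounded_below[OF J m]) auto
    finally show ?thesis .
  qed
  have "(\<integral>\<^sup>+x. epow (int_shifted_max J m g x) s * w x \<partial>lebesgue)
    \<le> (\<integral>\<^sup>+x. (\<integral>\<^sup>+i. c i * (indicator {x. ennreal (2 powr of_int i) < int_shifted_max J m g x} x * w x) \<partial>count_space UNIV) \<partial>lebesgue)"
  proof (intro nn_integral_mono)
    fix x :: "real ^ 'n"
    have "epow (int_shifted_max J m g x) s * w x
      \<le> (\<integral>\<^sup>+i. c i * indicator {i. ennreal (2 powr of_int i) < int_shifted_max J m g x} i \<partial>count_space UNIV) * w x"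
      unfolding c_def using s by (intro mult_right_mono epow_le_sum_levels) auto
    also have "\<dots> = (\<integral>\<^sup>+i. c i * (indicator {x. ennreal (2 powr of_int i) < int_shifted_max J m g x} x * w x) \<partial>count_space UNIV)"
      by (subst nn_integral_multc[symmetric]) (auto intro!: nn_integral_cong simp: indicator_def)
    finally show "epow (int_shifted_max J m g x) s * w x \<le> \<dots>" .
  qed
  also have "\<dots> = (\<integral>\<^sup>+i. c i * (\<integral>\<^sup>+x. indicator {x. ennreal (2 powr of_int i) < int_shifted_max J m g x} x * w x \<partial>lebesgue) \<partial>count_space UNIV)"
    by (subst nn_integral_count_space_nn_integral) (auto simp: nn_integral_cmult)
  also have "\<dots> \<le> (\<integral>\<^sup>+i. c i * (ennreal (2 powr - (of_int i - 1)) * (\<Sum>d\<in>?D. \<integral>\<^sup>+x. cut i (g x) * int_shifted_max J d w x \<partial>lebesgue)) \<partial>count_space UNIV)"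
    by (intro nn_integral_mono mult_left_mono level) auto
  also have "\<dots> = (\<integral>\<^sup>+i. (\<Sum>d\<in>?D. \<integral>\<^sup>+x. (c' i * cut i (g x)) * int_shifted_max J d w x \<partial>lebesgue) \<partial>count_space UNIV)"
  proof (intro nn_integral_cong)
    fix i :: int
    have "c i * ennreal (2 powr - (of_int i - 1)) = c' i"
      unfolding c_def c'_def by (simp add: algebra_simps flip: ennreal_mult powr_add)
    then show "c i * (ennreal (2 powr - (of_int i - 1)) * (\<Sum>d\<in>?D. \<integral>\<^sup>+x. cut i (g x) * int_shifted_max J d w x \<partial>lebesgue))
      = (\<Sum>d\<in>?D. \<integral>\<^sup>+x. (c' i * cut i (g x)) * int_shifted_max J d w x \<partial>lebesgue)"
      by (simp add: mult.assoc sum_distrib_left nn_integral_cmult flip: mult.assoc[of "c i"])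
  qed
  also have "\<dots> = (\<Sum>d\<in>?D. \<integral>\<^sup>+x. (\<integral>\<^sup>+i. c' i * cut i (g x) \<partial>count_space UNIV) * int_shifted_max J d w x \<partial>lebesgue)"
  proof (subst nn_integral_sum, simp, intro sum.cong refl)
    fix d :: "int ^ 'n"
    have "(\<integral>\<^sup>+i. (\<integral>\<^sup>+x. (c' i * cut i (g x)) * int_shifted_max J d w x \<partial>lebesgue) \<partial>count_space UNIV)
      = (\<integral>\<^sup>+x. (\<integral>\<^sup>+i. (c' i * cut i (g x)) * int_shifted_max J d w x \<partial>count_space UNIV) \<partial>lebesgue)"
      by (rule nn_integral_count_space_nn_integral[symmetric]) (simp, measurable)
    then show "(\<integral>\<^sup>+i. (\<integral>\<^sup>+x. (c' i * cut i (g x)) * int_shifted_max J d w x \<partial>lebesgue) \<partial>count_space UNIV)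
      = (\<integral>\<^sup>+x. (\<integral>\<^sup>+i. c' i * cut i (g x) \<partial>count_space UNIV) * int_shifted_max J d w x \<partial>lebesgue)"
      by (simp only: nn_integral_multc borel_measurable_count_space)
  qed
  also have "\<dots> \<le> (\<Sum>d\<in>?D. \<integral>\<^sup>+x. (ennreal (strong_const s) * epow (g x) s) * int_shifted_max J d w x \<partial>lebesgue)"
    unfolding c'_def cut_def
    by (intro sum_mono nn_integral_mono mult_right_mono sum_levels_le_epow s) auto
  also have "\<dots> = ennreal (strong_const s) * (\<Sum>d\<in>?D. \<integral>\<^sup>+x. epow (g x) s * int_shifted_max J d w x \<partial>lebesgue)"
    by (simp add: mult.assoc nn_integral_cmult sum_distrib_left)
  finally show ?thesis .
qed

lemma int_shifted_max_mono_scales: "I \<subseteq> J \<Longrightarrow> int_shifted_max I m g x \<le> int_shifted_max J m g x"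
  unfolding int_shifted_max_def by (rule SUP_subset_mono) auto

text \<open>Maximal stopping cubes need scales bounded below. The scales are truncated at -N, the
  constant does not depend on N, and monotone convergence removes the truncation.\<close>

lemma strong_type:
  fixes g w :: "real ^ 'n \<Rightarrow> ennreal" and m :: "int ^ 'n"
  assumes J: "lacunary K J" and m: "\<And>i. \<bar>m $ i\<bar> \<le> 2 ^ K" and s: "1 < s"
    and [measurable]: "g \<in> borel_measurable lebesgue" "w \<in> borel_measurable lebesgue"
  shows "(\<integral>\<^sup>+x. epow (int_shifted_max J m g x) s * w x \<partial>lebesgue)
    \<le> ennreal (strong_const s) * (\<Sum>d\<in>dual_shifts m. \<integral>\<^sup>+x. epow (g x) s * int_shifted_max J d w x \<partial>lebesgue)"
proof -
  define I where "I N = J \<inter> {- int N..}" for N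
  have I: "I N \<subseteq> {- int N..}" "I N \<subseteq> J" "lacunary K (I N)" for N
    using J by (auto simp: I_def lacunary_def)
  have "int_shifted_max J m g x = (SUP N. int_shifted_max (I N) m g x)" for x
  proof -
    have J_eq: "J = (\<Union>N. I N)"
    proof (intro set_eqI iffI)
      fix j assume "j \<in> J"
      then have "j \<in> I (nat (- j))" by (simp add: I_def)
      then show "j \<in> (\<Union>N. I N)" by blast
    qed (auto simp: I_def)
    show ?thesis unfolding int_shifted_max_def by (subst J_eq) (rule SUP_UNION)
  qed
  then have "(\<integral>\<^sup>+x. epow (int_shifted_max J m g x) s * w x \<partial>lebesgue)
    = (\<integral>\<^sup>+x. (SUP N. epow (int_shifted_max (I N) m g x) s * w x) \<partial>lebesgue)"
    using s by (simp add: epow_SUP SUP_mult_right_ennreal)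
  also have "\<dots> = (SUP N. \<integral>\<^sup>+x. epow (int_shifted_max (I N) m g x) s * w x \<partial>lebesgue)"
  proof (rule nn_integral_monotone_convergence_SUP)
    show "incseq (\<lambda>N x. epow (int_shifted_max (I N) m g x) s * w x)"
      using s by (intro monoI le_funI mult_right_mono epow_mono int_shifted_max_mono_scales)
        (auto simp: I_def)
  qed simp
  also have "\<dots> \<le> ennreal (strong_const s) * (\<Sum>d\<in>dual_shifts m. \<integral>\<^sup>+x. epow (g x) s * int_shifted_max J d w x \<partial>lebesgue)"
  proof (rule SUP_least)
    fix N
    have "(\<integral>\<^sup>+x. epow (int_shifted_max (I N) m g x) s * w x \<partial>lebesgue)
      \<le> ennreal (strong_const s) * (\<Sum>d\<in>dual_shifts m. \<integral>\<^sup>+x. epow (g x) s * int_shifted_max (I N) d w x \<partial>lebesgue)"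
      by (rule strong_type_bounded_below[OF I(1,3) m s]) auto
    also have "\<dots> \<le> ennreal (strong_const s) * (\<Sum>d\<in>dual_shifts m. \<integral>\<^sup>+x. epow (g x) s * int_shifted_max J d w x \<partial>lebesgue)"
      by (intro mult_left_mono sum_mono nn_integral_mono int_shifted_max_mono_scales I) auto
    finally show "(\<integral>\<^sup>+x. epow (int_shifted_max (I N) m g x) s * w x \<partial>lebesgue) \<le> \<dots>" .
  qed
  finally show ?thesis .
qed

lemma int_shifted_max_const_le: "int_shifted_max J m (\<lambda>_. c) x \<le> c"
  by (simp add: int_shifted_max_def cube_avg_const SUP_le_iff)

lemma card_dual_shifts_le: "card (dual_shifts (m :: int ^ 'n)) \<le> Suc (card (unit_shifts :: (int ^ 'n) set))"
  unfolding dual_shifts_def by (rule card_insert_le_m1) auto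

definition Lp_const :: "'n::finite itself \<Rightarrow> real \<Rightarrow> real" where
  "Lp_const _ s = strong_const s * real (Suc (card (unit_shifts :: (int ^ 'n) set)))"

text \<open>With weight 1 every dual operator is at most 1, so only the number of dual shifts
  enters. The constant is free of \<open>K\<close> and \<open>m\<close>, which the duality argument
  needs.\<close>

lemma strong_type_unweighted:
  fixes g :: "real ^ 'n \<Rightarrow> ennreal" and m :: "int ^ 'n"
  assumes J: "lacunary K J" and m: "\<And>i. \<bar>m $ i\<bar> \<le> 2 ^ K" and s: "1 < s"
    and [measurable]: "g \<in> borel_measurable lebesgue"
  shows "(\<integral>\<^sup>+x. epow (int_shifted_max J m g x) s \<partial>lebesgue)
    \<le> ennreal (Lp_const TYPE('n) s) * (\<integral>\<^sup>+x. epow (g x) s \<partial>lebesgue)"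
proof -
  let ?I = "\<integral>\<^sup>+x. epow (g x) s \<partial>lebesgue"
  have "(\<integral>\<^sup>+x. epow (int_shifted_max J m g x) s \<partial>lebesgue)
    \<le> ennreal (strong_const s) * (\<Sum>d\<in>dual_shifts m. \<integral>\<^sup>+x. epow (g x) s * int_shifted_max J d (\<lambda>_. 1) x \<partial>lebesgue)"
    using strong_type[OF J m s, of g "\<lambda>_. 1"] by simp
  also have "\<dots> \<le> ennreal (strong_const s) * (\<Sum>d\<in>dual_shifts m. \<integral>\<^sup>+x. epow (g x) s * 1 \<partial>lebesgue)"
    by (intro mult_left_mono sum_mono nn_integral_mono int_shifted_max_const_le) auto
  also have "\<dots> = ennreal (strong_const s) * (of_nat (card (dual_shifts m)) * ?I)"
    by simp
  also have "\<dots> \<le> ennreal (strong_const s) * (of_nat (Suc (card (unit_shifts :: (int ^ 'n) set))) * ?I)"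
    by (intro mult_left_mono mult_right_mono of_nat_mono card_dual_shifts_le) auto
  also have "\<dots> = ennreal (Lp_const TYPE('n) s) * ?I"
    using strong_const_pos[OF s]
    by (simp add: Lp_const_def ennreal_mult mult.assoc ennreal_of_nat_eq_real_of_nat del: of_nat_Suc)
  finally show ?thesis .
qed

subsection \<open>From real to integer shifts\<close>

lemma sets_dcube_shift [measurable]: "dcube_shift y j a \<in> sets lebesgue"
proof -
  have "dcube_shift y j a = (\<lambda>z. z - dlen j *\<^sub>R y) -` dcube j a \<inter> space borel"
    unfolding dcube_shift_def by (auto intro!: image_eqI[of _ _ "_ - dlen j *\<^sub>R y"])
  also have "\<dots> \<in> sets borel" by (intro measurable_sets[of _ borel borel] sets_dcube) simp
  finally show ?thesis by auto
qed

lemma shifted_max_eq: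
  "shifted_max y g x = (SUP j. ennreal (1 / dlen j ^ CARD('n)) *
    (\<integral>\<^sup>+ z \<in> dcube_shift y j (dindex j x). g z \<partial>lebesgue))"
  for y :: "real ^ 'n"
proof -
  have "{(j, m). x \<in> dcube j m} = (\<lambda>j. (j, dindex j x)) ` UNIV"
    by (auto simp: mem_dcube_iff)
  then show ?thesis unfolding shifted_max_def by (simp add: image_image)
qed

lemma shifted_max_measurable [measurable]: "shifted_max y g \<in> borel_measurable lebesgue"
proof -
  have "(\<lambda>x. ennreal (1 / dlen j ^ CARD('n)) *
    (\<integral>\<^sup>+ z \<in> dcube_shift y j (dindex j x). g z \<partial>lebesgue)) \<in> borel_measurable lebesgue" for j
    by (rule measurable_compose[OF dindex_measurable]) simp
  then show ?thesis
    unfolding shifted_max_eq[abs_def] by (intro borel_measurable_SUP) auto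
qed

lemma shifted_max_mono: "(\<And>x. g x \<le> h x) \<Longrightarrow> shifted_max y g x \<le> shifted_max y h x"
  unfolding shifted_max_def by (intro SUP_mono' mult_left_mono nn_integral_mono mult_right_mono) auto

text \<open>Hoelder's inequality on each shifted cube. It is used to separate the factors of
  \<open>g\<close> when the outer exponent is below the inner one.\<close>

lemma shifted_max_Hoelder:
  fixes y :: "real ^ 'n"
  assumes [measurable]: "h \<in> borel_measurable lebesgue" "f \<in> borel_measurable lebesgue"
    and \<theta>: "0 < \<theta>" "\<theta> < 1"
    and le: "\<And>x. g x \<le> epow (h x) \<theta> * epow (f x) (1 - \<theta>)"
  shows "shifted_max y g x \<le> 2 * (epow (shifted_max y h x) \<theta> * epow (shifted_max y f x) (1 - \<theta>))"
  unfolding shifted_max_eq[of y g]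
proof (rule SUP_least)
  fix j :: int
  define c where "c = ennreal (1 / dlen j ^ CARD('n))"
  define Q where "Q = dcube_shift y j (dindex j x)"
  have [measurable]: "Q \<in> sets lebesgue" by (simp add: Q_def)
  have "(\<integral>\<^sup>+z\<in>Q. g z \<partial>lebesgue)
    \<le> (\<integral>\<^sup>+z. epow (h z * indicator Q z) \<theta> * epow (f z * indicator Q z) (1 - \<theta>) \<partial>lebesgue)"
    by (intro nn_integral_mono) (auto simp: indicator_def le)
  also have "\<dots> \<le> 2 * (epow (\<integral>\<^sup>+z\<in>Q. h z \<partial>lebesgue) \<theta> * epow (\<integral>\<^sup>+z\<in>Q. f z \<partial>lebesgue) (1 - \<theta>))"
    by (intro nn_integral_Hoelder \<theta>) auto
  finally have "c * (\<integral>\<^sup>+z\<in>Q. g z \<partial>lebesgue)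
    \<le> c * (2 * (epow (\<integral>\<^sup>+z\<in>Q. h z \<partial>lebesgue) \<theta> * epow (\<integral>\<^sup>+z\<in>Q. f z \<partial>lebesgue) (1 - \<theta>)))"
    by (intro mult_left_mono) auto
  also have "\<dots> = 2 * (epow (c * (\<integral>\<^sup>+z\<in>Q. h z \<partial>lebesgue)) \<theta> * epow (c * (\<integral>\<^sup>+z\<in>Q. f z \<partial>lebesgue)) (1 - \<theta>))"
  proof -
    \<comment> \<open>The normalising factor is split as \<open>c\<close> to the power \<theta>
      times \<open>c\<close> to the power 1 - \<theta>, so that each integral becomes an
      average.\<close>
    have "c * a = (epow c \<theta> * epow c (1 - \<theta>)) * a" for a by (simp flip: epow_add)
    then have "c * (2 * (epow H \<theta> * epow F (1 - \<theta>)))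
      = (epow c \<theta> * epow c (1 - \<theta>)) * (2 * (epow H \<theta> * epow F (1 - \<theta>)))" for H F by blast
    also have "\<dots> H F = 2 * (epow (c * H) \<theta> * epow (c * F) (1 - \<theta>))" for H F
      by (simp only: epow_mult mult_ac)
    finally show ?thesis .
  qed
  also have "\<dots> \<le> 2 * (epow (shifted_max y h x) \<theta> * epow (shifted_max y f x) (1 - \<theta>))"
    unfolding shifted_max_eq c_def Q_def using \<theta>
    by (intro mult_left_mono mult_mono epow_mono SUP_upper) auto
  finally show "ennreal (1 / dlen j ^ CARD('n)) * (\<integral>\<^sup>+z\<in>dcube_shift y j (dindex j x). g z \<partial>lebesgue) \<le> \<dots>"
    unfolding c_def Q_def .
qed

section \<open>Covering a shifted cube by dyadic cubes of the same size\<close>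

definition corner_shifts :: "(int ^ 'n) set" where
  "corner_shifts = {e. \<forall>i. e $ i \<in> {0..1}}"

lemma finite_corner_shifts [simp]: "finite corner_shifts"
  unfolding corner_shifts_def by (rule finite_vec_range) simp

definition vfloor :: "real ^ 'n \<Rightarrow> int ^ 'n" where
  "vfloor y = (\<chi> i. \<lfloor>y $ i\<rfloor>)"

text \<open>In each coordinate the floor of a sum exceeds the sum of the floors by 0 or 1.\<close>

lemma dcube_shift_subset: "dcube_shift y j a \<subseteq> (\<Union>e\<in>corner_shifts. dcube j (a + (vfloor y + e)))"
proof
  fix z assume "z \<in> dcube_shift y j a"
  then obtain x where x: "dindex j x = a" "z = x + dlen j *\<^sub>R y"
    by (auto simp: dcube_shift_def mem_dcube_iff)
  have "\<lfloor>z $ i / dlen j\<rfloor> - a $ i - \<lfloor>y $ i\<rfloor> \<in> {0..1}" for i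
  proof -
    have "z $ i / dlen j = x $ i / dlen j + y $ i" using x by (simp add: field_simps)
    then show ?thesis using x unfolding x(1)[symmetric] dindex_nth atLeastAtMost_iff by linarith
  qed
  then have "dindex j z - a - vfloor y \<in> corner_shifts"
    by (simp add: corner_shifts_def vfloor_def)
  then show "z \<in> (\<Union>e\<in>corner_shifts. dcube j (a + (vfloor y + e)))"
    by (intro UN_I[of "dindex j z - a - vfloor y"]) (auto simp: mem_dcube_iff)
qed

lemma shifted_max_le_int_shifted_max:
  fixes y :: "real ^ 'n"
  assumes [measurable]: "g \<in> borel_measurable lebesgue"
  shows "shifted_max y g x \<le> (\<Sum>e\<in>corner_shifts. int_shifted_max UNIV (vfloor y + e) g x)"
  unfolding shifted_max_eq
proof (rule SUP_least)
  fix j :: int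
  define c where "c = ennreal (1 / dlen j ^ CARD('n))"
  have "(\<integral>\<^sup>+z\<in>dcube_shift y j (dindex j x). g z \<partial>lebesgue)
    \<le> (\<integral>\<^sup>+z. (\<Sum>e\<in>corner_shifts. g z * indicator (dcube j (dindex j x + (vfloor y + e))) z) \<partial>lebesgue)"
  proof (intro nn_integral_mono)
    fix z
    show "g z * indicator (dcube_shift y j (dindex j x)) z
      \<le> (\<Sum>e\<in>corner_shifts. g z * indicator (dcube j (dindex j x + (vfloor y + e))) z)"
    proof (cases "z \<in> dcube_shift y j (dindex j x)")
      case True
      then obtain e where e: "e \<in> corner_shifts" "z \<in> dcube j (dindex j x + (vfloor y + e))"
        using dcube_shift_subset by blast
      then have "g z * indicator (dcube_shift y j (dindex j x)) z
        = g z * indicator (dcube j (dindex j x + (vfloor y + e))) z" using True by simp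
      also have "\<dots> \<le> (\<Sum>e\<in>corner_shifts. g z * indicator (dcube j (dindex j x + (vfloor y + e))) z)"
        using e by (intro member_le_sum) auto
      finally show ?thesis .
    qed simp
  qed
  also have "\<dots> = (\<Sum>e\<in>corner_shifts. \<integral>\<^sup>+z\<in>dcube j (dindex j x + (vfloor y + e)). g z \<partial>lebesgue)"
    by (subst nn_integral_sum) auto
  finally have "c * (\<integral>\<^sup>+z\<in>dcube_shift y j (dindex j x). g z \<partial>lebesgue)
    \<le> c * (\<Sum>e\<in>corner_shifts. \<integral>\<^sup>+z\<in>dcube j (dindex j x + (vfloor y + e)). g z \<partial>lebesgue)"
    by (rule mult_left_mono) simp
  also have "\<dots> = (\<Sum>e\<in>corner_shifts. cube_avg j (dindex j x + (vfloor y + e)) g)"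
    by (simp add: sum_distrib_left cube_avg_def c_def)
  also have "\<dots> \<le> (\<Sum>e\<in>corner_shifts. int_shifted_max UNIV (vfloor y + e) g x)"
    unfolding int_shifted_max_def by (intro sum_mono SUP_upper) auto
  finally show "ennreal (1 / dlen j ^ CARD('n)) * (\<integral>\<^sup>+z\<in>dcube_shift y j (dindex j x). g z \<partial>lebesgue) \<le> \<dots>"
    unfolding c_def .
qed

section \<open>Residue classes of scales and the dual weight\<close>

definition residue_class :: "nat \<Rightarrow> int \<Rightarrow> int set" where
  "residue_class K c = {j. j mod int K = c}"

lemma lacunary_residue_class: "lacunary K (residue_class K c)"
  unfolding lacunary_def residue_class_def
proof (intro ballI impI)
  fix j j' assume *: "j \<in> {j. j mod int K = c}" "j' \<in> {j. j mod int K = c}" "j < j'"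
  then have "j' mod int K = j mod int K" by simp
  then have "int K dvd j' - j" by (metis mod_eq_dvd_iff)
  then show "int K \<le> j' - j" using * by (intro zdvd_imp_le) auto
qed

text \<open>The supremum over all scales is a maximum over \<open>K\<close> classes. It is replaced
  by a sum only after raising to the power \<open>s\<close>, so the number of classes costs K^(1/s)
  rather than K in the norm.\<close>

lemma epow_int_shifted_max_UNIV_le:
  assumes "0 < K" "0 < s"
  shows "epow (int_shifted_max UNIV m g x) s
    \<le> (\<Sum>c\<in>{0..<int K}. epow (int_shifted_max (residue_class K c) m g x) s)"
proof -
  have "(UNIV :: int set) = (\<Union>c\<in>{0..<int K}. residue_class K c)"
    using assms by (auto simp: residue_class_def)
  then have "int_shifted_max UNIV m g x = int_shifted_max (\<Union>c\<in>{0..<int K}. residue_class K c) m g x"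
    by simp
  also have "\<dots> = (SUP c\<in>{0..<int K}. int_shifted_max (residue_class K c) m g x)"
    unfolding int_shifted_max_def by (rule SUP_UNION)
  finally have "epow (int_shifted_max UNIV m g x) s
    = (SUP c\<in>{0..<int K}. epow (int_shifted_max (residue_class K c) m g x) s)"
    using assms by (simp add: epow_SUP)
  also have "\<dots> \<le> (\<Sum>c\<in>{0..<int K}. epow (int_shifted_max (residue_class K c) m g x) s)"
    by (intro SUP_least member_le_sum) auto
  finally show ?thesis .
qed

text \<open>The weight \<open>N w\<close> of the duality argument: all operators that
  \<open>strong_type\<close> puts on \<open>w\<close>, collected over corner shifts and residue
  classes.\<close>

definition dual_weight :: "real ^ 'n \<Rightarrow> nat \<Rightarrow> (real ^ 'n \<Rightarrow> ennreal) \<Rightarrow> real ^ 'n \<Rightarrow> ennreal" where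
  "dual_weight y K w x = (\<Sum>e\<in>corner_shifts. \<Sum>c\<in>{0..<int K}. \<Sum>d\<in>dual_shifts (vfloor y + e).
     int_shifted_max (residue_class K c) d w x)"

lemma dual_weight_measurable [measurable]: "dual_weight y K w \<in> borel_measurable lebesgue"
  unfolding dual_weight_def[abs_def] by measurable

definition shift_count :: "'n::finite itself \<Rightarrow> nat" where
  "shift_count _ = card (corner_shifts :: (int ^ 'n) set) * Suc (card (unit_shifts :: (int ^ 'n) set))"

text \<open>The floor of \<open>y $ i\<close> plus 0 or 1 lies between \<open>y $ i - 1\<close> and
  \<open>y $ i + 1\<close>.\<close>

lemma vfloor_shift_bound:
  assumes "\<And>i. \<bar>y $ i\<bar> + 1 \<le> 2 ^ K" "e \<in> corner_shifts"
  shows "\<bar>(vfloor y + e) $ i\<bar> \<le> 2 ^ K"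
proof -
  have e: "e $ i \<in> {0..1}" using assms(2) by (simp add: corner_shifts_def)
  have "real_of_int \<bar>\<lfloor>y $ i\<rfloor> + e $ i\<bar> \<le> \<bar>y $ i\<bar> + 1"
    using e by (simp only: atLeastAtMost_iff) linarith
  also have "\<dots> \<le> real_of_int (2 ^ K)" using assms(1) by simp
  finally show ?thesis by (simp only: of_int_le_iff vfloor_def vec_lambda_beta vector_add_component)
qed

text \<open>The dual shifts obey the same size bound, so the scalar estimates apply again to the
  operators inside the dual weight.\<close>

lemma dual_shifts_bound:
  assumes "d \<in> dual_shifts m" "\<And>i. \<bar>m $ i\<bar> \<le> 2 ^ K"
  shows "\<bar>d $ i\<bar> \<le> 2 ^ K"
proof (cases "d = - m")
  case False
  then have "d $ i \<in> {-1..1}" using assms by (simp add: dual_shifts_def unit_shifts_def)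
  then have "\<bar>d $ i\<bar> \<le> 1" by (simp add: abs_le_iff)
  also have "(1 :: int) \<le> 2 ^ K" by simp
  finally show ?thesis .
qed (use assms in simp)

text \<open>Counts the summands of the dual weight. The summand is left abstract to serve both
  pointwise values and integrals against the dual weight.\<close>

lemma sum_dual_shifts_le:
  fixes y :: "real ^ 'n"
  assumes y: "\<And>i. \<bar>y $ i\<bar> + 1 \<le> 2 ^ K"
    and B: "\<And>c d. (\<And>i. \<bar>d $ i\<bar> \<le> 2 ^ K) \<Longrightarrow> \<phi> c d \<le> B"
  shows "(\<Sum>e\<in>corner_shifts. \<Sum>c\<in>{0..<int K}. \<Sum>d\<in>dual_shifts (vfloor y + e). \<phi> c d)
    \<le> ennreal (real (shift_count TYPE('n) * K)) * B"
proof -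
  let ?u = "of_nat (Suc (card (unit_shifts :: (int ^ 'n) set))) :: ennreal"
  have 1: "(\<Sum>d\<in>dual_shifts (vfloor y + e). \<phi> c d) \<le> ?u * B" if e: "e \<in> corner_shifts" for c e
  proof -
    have "(\<Sum>d\<in>dual_shifts (vfloor y + e). \<phi> c d) \<le> of_nat (card (dual_shifts (vfloor y + e))) * B"
      by (intro sum_bounded_above B dual_shifts_bound[OF _ vfloor_shift_bound[OF y e]])
    also have "\<dots> \<le> ?u * B"
      by (intro mult_right_mono of_nat_mono card_dual_shifts_le) auto
    finally show ?thesis .
  qed
  have "(\<Sum>e\<in>corner_shifts. \<Sum>c\<in>{0..<int K}. \<Sum>d\<in>dual_shifts (vfloor y + e). \<phi> c d)
    \<le> (\<Sum>e\<in>(corner_shifts :: (int ^ 'n) set). \<Sum>c\<in>{0..<int K}. ?u * B)"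
    by (intro sum_mono 1)
  also have "\<dots> = ennreal (real (shift_count TYPE('n) * K)) * B"
  proof -
    have "ennreal (real (shift_count TYPE('n) * K)) = of_nat (shift_count TYPE('n) * K)"
      by (simp only: ennreal_of_nat_eq_real_of_nat)
    then show ?thesis
      by (simp only: shift_count_def sum_constant card_atLeastLessThan_int of_nat_mult diff_zero nat_int mult_ac)
  qed
  finally show ?thesis .
qed

definition weighted_const :: "'n::finite itself \<Rightarrow> real \<Rightarrow> real" where
  "weighted_const _ s = real (card (corner_shifts :: (int ^ 'n) set)) powr s * strong_const s"

lemma card_corner_shifts_pos: "0 < card (corner_shifts :: (int ^ 'n) set)"
proof -
  have "0 \<in> (corner_shifts :: (int ^ 'n) set)" by (simp add: corner_shifts_def)
  then show ?thesis by (auto simp: card_gt_0_iff)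
qed

lemma shift_count_pos: "0 < shift_count TYPE('n::finite)"
  using card_corner_shifts_pos[where 'n = 'n] by (simp add: shift_count_def)

lemma weighted_const_pos: "1 < s \<Longrightarrow> 0 < weighted_const TYPE('n::finite) s"
  using strong_const_pos[of s] card_corner_shifts_pos[where 'n = 'n] by (simp add: weighted_const_def zero_less_mult_iff card_gt_0_iff)

text \<open>\<open>strong_type\<close> is applied to each corner shift and residue class. The
  constant does not involve \<open>K\<close>; the loss is hidden in the number of terms of
  \<open>dual_weight\<close>.\<close>

lemma shifted_max_weighted:
  fixes y :: "real ^ 'n"
  assumes K: "0 < K" and y: "\<And>i. \<bar>y $ i\<bar> + 1 \<le> 2 ^ K" and s: "1 < s"
    and [measurable]: "g \<in> borel_measurable lebesgue" "w \<in> borel_measurable lebesgue"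
  shows "(\<integral>\<^sup>+x. epow (shifted_max y g x) s * w x \<partial>lebesgue)
    \<le> ennreal (weighted_const TYPE('n) s) * (\<integral>\<^sup>+x. epow (g x) s * dual_weight y K w x \<partial>lebesgue)"
proof -
  define N where "N = ennreal (real (card (corner_shifts :: (int ^ 'n) set)) powr s)"
  have "(\<integral>\<^sup>+x. epow (shifted_max y g x) s * w x \<partial>lebesgue)
    \<le> (\<integral>\<^sup>+x. (N * (\<Sum>e\<in>corner_shifts. \<Sum>c\<in>{0..<int K}.
        epow (int_shifted_max (residue_class K c) (vfloor y + e) g x) s)) * w x \<partial>lebesgue)"
  proof (intro nn_integral_mono mult_right_mono)
    fix x :: "real ^ 'n"
    have "epow (shifted_max y g x) s \<le> epow (\<Sum>e\<in>corner_shifts. int_shifted_max UNIV (vfloor y + e) g x) s"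
      using s by (intro epow_mono shifted_max_le_int_shifted_max) auto
    also have "\<dots> \<le> N * (\<Sum>e\<in>corner_shifts. epow (int_shifted_max UNIV (vfloor y + e) g x) s)"
      unfolding N_def using s by (intro epow_sum_le) auto
    also have "\<dots> \<le> N * (\<Sum>e\<in>corner_shifts. \<Sum>c\<in>{0..<int K}.
        epow (int_shifted_max (residue_class K c) (vfloor y + e) g x) s)"
      using s K by (intro mult_left_mono sum_mono epow_int_shifted_max_UNIV_le) auto
    finally show "epow (shifted_max y g x) s \<le> \<dots>" .
  qed simp
  also have "\<dots> = N * (\<Sum>e\<in>corner_shifts. \<Sum>c\<in>{0..<int K}.
      \<integral>\<^sup>+x. epow (int_shifted_max (residue_class K c) (vfloor y + e) g x) s * w x \<partial>lebesgue)"
    by (simp add: mult.assoc sum_distrib_right nn_integral_cmult nn_integral_sum)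
  also have "\<dots> \<le> N * (\<Sum>e\<in>corner_shifts. \<Sum>c\<in>{0..<int K}. ennreal (strong_const s) *
      (\<Sum>d\<in>dual_shifts (vfloor y + e). \<integral>\<^sup>+x. epow (g x) s * int_shifted_max (residue_class K c) d w x \<partial>lebesgue))"
    by (intro mult_left_mono sum_mono strong_type[OF lacunary_residue_class vfloor_shift_bound[OF y] s]) auto
  also have "\<dots> = (N * ennreal (strong_const s)) * (\<integral>\<^sup>+x. epow (g x) s * dual_weight y K w x \<partial>lebesgue)"
    by (simp add: dual_weight_def sum_distrib_left nn_integral_sum mult.assoc nn_integral_cmult)
  also have "N * ennreal (strong_const s) = ennreal (weighted_const TYPE('n) s)"
    using strong_const_pos[OF s] by (simp add: N_def weighted_const_def ennreal_mult)
  finally show ?thesis .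
qed

text \<open>With weight 1 the dual weight is at most its number of terms, a multiple of
  \<open>K\<close>.\<close>

lemma shifted_max_Lp:
  fixes y :: "real ^ 'n"
  assumes K: "0 < K" and y: "\<And>i. \<bar>y $ i\<bar> + 1 \<le> 2 ^ K" and s: "1 < s"
    and [measurable]: "g \<in> borel_measurable lebesgue"
  shows "(\<integral>\<^sup>+x. epow (shifted_max y g x) s \<partial>lebesgue)
    \<le> ennreal (weighted_const TYPE('n) s * real (shift_count TYPE('n) * K)) * (\<integral>\<^sup>+x. epow (g x) s \<partial>lebesgue)"
proof -
  have "(\<integral>\<^sup>+x. epow (shifted_max y g x) s \<partial>lebesgue)
    \<le> ennreal (weighted_const TYPE('n) s) * (\<integral>\<^sup>+x. epow (g x) s * dual_weight y K (\<lambda>_. 1) x \<partial>lebesgue)"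
    using shifted_max_weighted[OF K y s, of g "\<lambda>_. 1"] by simp
  also have "\<dots> \<le> ennreal (weighted_const TYPE('n) s) * (\<integral>\<^sup>+x. epow (g x) s *
      (ennreal (real (shift_count TYPE('n) * K)) * 1) \<partial>lebesgue)"
    unfolding dual_weight_def
    by (intro mult_left_mono nn_integral_mono sum_dual_shifts_le y int_shifted_max_const_le) auto
  also have "\<dots> = ennreal (weighted_const TYPE('n) s * real (shift_count TYPE('n) * K)) * (\<integral>\<^sup>+x. epow (g x) s \<partial>lebesgue)"
    using weighted_const_pos[OF s, where 'n = 'n]
    by (simp add: nn_integral_multc ennreal_mult mult_ac del: of_nat_mult)
  finally show ?thesis .
qed

subsection \<open>Vector-valued inequalities\<close>

lemma borel_measurable_nn_integral_int [measurable]: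
  assumes "\<And>k :: int. f k \<in> borel_measurable M"
  shows "(\<lambda>x. \<integral>\<^sup>+k. f k x \<partial>count_space UNIV) \<in> borel_measurable M"
proof -
  have "(\<integral>\<^sup>+k. f k x \<partial>count_space UNIV) = (\<Sum>n. f (int_decode n) x)" for x
    using nn_integral_bij_count_space[OF bij_int_decode, of "\<lambda>k. f k x"]
    by (simp add: nn_integral_count_space_nat)
  then show ?thesis using assms by simp
qed

text \<open>The s-th power of the l^s norm, without the root: its power \<rho> integrates to the
  \<rho> s-th power of a norm in L^(\<rho> s)(l^s).\<close>

definition vector_shifted_max where
  "vector_shifted_max y g s x = (\<integral>\<^sup>+k. epow (shifted_max y (g k) x) s \<partial>count_space (UNIV :: int set))"

lemma vector_shifted_max_measurable [measurable]:
  "vector_shifted_max y g s \<in> borel_measurable lebesgue"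
  unfolding vector_shifted_max_def[abs_def] by measurable

text \<open>With equal inner and outer exponents, sum and integral can be exchanged and the scalar
  bound applies to each \<open>k\<close>.\<close>

lemma vector_shifted_max_bound_eq:
  fixes y :: "real ^ 'n" and g :: "int \<Rightarrow> real ^ 'n \<Rightarrow> ennreal"
  assumes K: "0 < K" and y: "\<And>i. \<bar>y $ i\<bar> + 1 \<le> 2 ^ K" and s: "1 < s"
    and [measurable]: "\<And>k. g k \<in> borel_measurable lebesgue"
  shows "(\<integral>\<^sup>+x. vector_shifted_max y g s x \<partial>lebesgue)
    \<le> ennreal (weighted_const TYPE('n) s * real (shift_count TYPE('n) * K)) *
       (\<integral>\<^sup>+x. (\<integral>\<^sup>+k. epow (g k x) s \<partial>count_space UNIV) \<partial>lebesgue)"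
proof -
  have "(\<integral>\<^sup>+x. vector_shifted_max y g s x \<partial>lebesgue)
    = (\<integral>\<^sup>+k. (\<integral>\<^sup>+x. epow (shifted_max y (g k) x) s \<partial>lebesgue) \<partial>count_space UNIV)"
    unfolding vector_shifted_max_def by (rule nn_integral_count_space_nn_integral) auto
  also have "\<dots> \<le> (\<integral>\<^sup>+k. ennreal (weighted_const TYPE('n) s * real (shift_count TYPE('n) * K)) *
      (\<integral>\<^sup>+x. epow (g k x) s \<partial>lebesgue) \<partial>count_space UNIV)"
    by (intro nn_integral_mono shifted_max_Lp K y s) auto
  also have "\<dots> = ennreal (weighted_const TYPE('n) s * real (shift_count TYPE('n) * K)) *
      (\<integral>\<^sup>+k. (\<integral>\<^sup>+x. epow (g k x) s \<partial>lebesgue) \<partial>count_space UNIV)"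
    by (rule nn_integral_cmult) simp
  also have "(\<integral>\<^sup>+k. (\<integral>\<^sup>+x. epow (g k x) s \<partial>lebesgue) \<partial>count_space UNIV)
    = (\<integral>\<^sup>+x. (\<integral>\<^sup>+k. epow (g k x) s \<partial>count_space UNIV) \<partial>lebesgue)"
    by (rule nn_integral_count_space_nn_integral[symmetric]) auto
  finally show ?thesis .
qed

text \<open>Writing \<open>F = (\<Sum>\<^sub>k g\<^sub>k\<^sup>s)\<^sup>1\<^sup>/\<^sup>s\<close> and \<open>\<theta> = r/s\<close>, one factors \<open>g\<^sub>k = h\<^sub>k\<^sup>\<theta> F\<^sup>1\<^sup>-\<^sup>\<theta>\<close> with
  \<open>\<Sum>\<^sub>k h\<^sub>k\<^sup>r = F\<^sup>r\<close>; Hoelder's inequality for the averages and for the integral then reduces the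
  vector-valued bound to the scalar one for \<open>h\<^sub>k\<close> and \<open>F\<close> in \<open>L\<^sup>r\<close>.\<close>

lemma vector_shifted_max_bound_less:
  fixes y :: "real ^ 'n" and g :: "int \<Rightarrow> real ^ 'n \<Rightarrow> ennreal"
  assumes K: "0 < K" and y: "\<And>i. \<bar>y $ i\<bar> + 1 \<le> 2 ^ K"
    and s: "0 < s" and \<theta>: "0 < \<theta>" "\<theta> < 1" "1 < \<theta> * s"
    and [measurable]: "\<And>k. g k \<in> borel_measurable lebesgue"
  shows "(\<integral>\<^sup>+x. epow (vector_shifted_max y g s x) \<theta> \<partial>lebesgue)
    \<le> ennreal (2 * 2 powr (s * \<theta>)) * (ennreal (weighted_const TYPE('n) (\<theta> * s) * real (shift_count TYPE('n) * K)) *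
       (\<integral>\<^sup>+x. epow (\<integral>\<^sup>+k. epow (g k x) s \<partial>count_space UNIV) \<theta> \<partial>lebesgue))"
proof -
  define G where "G x = (\<integral>\<^sup>+k. epow (g k x) s \<partial>count_space UNIV)" for x
  define F where "F x = epow (G x) (1 / s)" for x
  \<comment> \<open>Solving \<open>g\<close> = \<open>h\<close>^\<theta>
    \<open>F\<close>^(1-\<theta>) for \<open>h\<close> gives \<open>h\<close>^(\<theta> s) =
    \<open>g\<close>^s / \<open>G\<close>^(1-\<theta>). Where \<open>G\<close> is infinite, the
    value top keeps the factorisation valid as an upper bound.\<close>
  define h where "h k x = (if G x = top then top else epow (epow (g k x) s / epow (G x) (1 - \<theta>)) (1 / (\<theta> * s)))" for k x
  define A where "A = ennreal (weighted_const TYPE('n) (\<theta> * s) * real (shift_count TYPE('n) * K))"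
  define X where "X = (\<integral>\<^sup>+x. epow (G x) \<theta> \<partial>lebesgue)"
  define S where "S = vector_shifted_max y h (\<theta> * s)"
  have [measurable]: "G \<in> borel_measurable lebesgue"
    unfolding G_def[abs_def] by measurable
  have [measurable]: "F \<in> borel_measurable lebesgue" "h k \<in> borel_measurable lebesgue"
    "S \<in> borel_measurable lebesgue" for k
    unfolding F_def[abs_def] h_def[abs_def] S_def by measurable
  have A_le: "(\<integral>\<^sup>+x. epow (shifted_max y F x) (\<theta> * s) \<partial>lebesgue) \<le> A * X"
    using shifted_max_Lp[OF K y \<theta>(3), of F] s by (simp add: A_def X_def F_def)
  have factor: "g k x \<le> epow (h k x) \<theta> * epow (F x) (1 - \<theta>)" for k x
  proof -
    have le: "epow (g k x) s \<le> G x" unfolding G_def by (rule nn_integral_ge_point) simp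
    consider "G x = 0" | "G x = top" | "G x \<noteq> 0" "G x \<noteq> top" by blast
    then show ?thesis
    proof cases
      case 1
      then show ?thesis using le by simp
    next
      case 2
      then show ?thesis by (simp add: h_def F_def)
    next
      case 3
      have "epow (h k x) \<theta> * epow (F x) (1 - \<theta>)
        = epow (epow (g k x) s / epow (G x) (1 - \<theta>) * epow (G x) (1 - \<theta>)) (1 / s)"
        using 3 s \<theta> by (simp add: h_def F_def epow_mult)
      also have "epow (g k x) s / epow (G x) (1 - \<theta>) * epow (G x) (1 - \<theta>) = epow (g k x) s"
        using 3 mult_divide_eq_ennreal[of "epow (G x) (1 - \<theta>)"]
        by (simp add: ennreal_divide_times mult.commute ennreal_times_divide)
      finally show ?thesis using s by simp
    qed
  qed
  \<comment> \<open>Finiteness of \<open>X\<close> makes \<open>G\<close> finite almost everywhere,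
    so the exceptional value of \<open>h\<close> is harmless and the sum of
    \<open>h\<close>^(\<theta> s) over \<open>k\<close> is at most
    \<open>G\<close>^\<theta>.\<close>
  have S_le: "(\<integral>\<^sup>+x. S x \<partial>lebesgue) \<le> A * X" if "X < top"
  proof -
    have "AE x in lebesgue. epow (G x) \<theta> \<noteq> top"
      using that unfolding X_def by (intro nn_integral_PInf_AE[unfolded infinity_ennreal_def]) auto
    then have "AE x in lebesgue. (\<integral>\<^sup>+k. epow (h k x) (\<theta> * s) \<partial>count_space UNIV) \<le> epow (G x) \<theta>"
    proof (rule AE_mp, intro AE_I2 impI)
      fix x assume "epow (G x) \<theta> \<noteq> top"
      then have fin: "G x \<noteq> top" by simp
      have "(\<integral>\<^sup>+k. epow (h k x) (\<theta> * s) \<partial>count_space UNIV)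
        = (\<integral>\<^sup>+k. epow (g k x) s / epow (G x) (1 - \<theta>) \<partial>count_space UNIV)"
        using fin \<theta> s by (simp add: h_def)
      also have "\<dots> = G x / epow (G x) (1 - \<theta>)"
        unfolding G_def by (rule nn_integral_divide) simp
      also have "\<dots> = epow (G x) (\<theta> + (1 - \<theta>)) / epow (G x) (1 - \<theta>)" by simp
      also have "\<dots> \<le> epow (G x) \<theta>"
        unfolding epow_add
        using fin mult_divide_eq_ennreal[of "epow (G x) (1 - \<theta>)"] by (cases "G x = 0") auto
      finally show "(\<integral>\<^sup>+k. epow (h k x) (\<theta> * s) \<partial>count_space UNIV) \<le> epow (G x) \<theta>" .
    qed
    then have "(\<integral>\<^sup>+x. (\<integral>\<^sup>+k. epow (h k x) (\<theta> * s) \<partial>count_space UNIV) \<partial>lebesgue) \<le> X"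
      unfolding X_def by (rule nn_integral_mono_AE)
    then have "A * (\<integral>\<^sup>+x. (\<integral>\<^sup>+k. epow (h k x) (\<theta> * s) \<partial>count_space UNIV) \<partial>lebesgue) \<le> A * X"
      by (rule mult_left_mono) simp
    then show ?thesis
      using vector_shifted_max_bound_eq[OF K y \<theta>(3), of h] unfolding A_def S_def by simp
  qed
  \<comment> \<open>Hoelder's inequality for the averages leaves a factor with \<open>F\<close> that
    does not depend on \<open>k\<close> and can be taken out of the sum.\<close>
  have pointwise: "epow (vector_shifted_max y g s x) \<theta>
    \<le> ennreal (2 powr (s * \<theta>)) * (epow (S x) \<theta> * epow (epow (shifted_max y F x) (\<theta> * s)) (1 - \<theta>))" for x
  proof -
    have "vector_shifted_max y g s x
      \<le> (\<integral>\<^sup>+k. (ennreal (2 powr s) * epow (shifted_max y F x) ((1 - \<theta>) * s)) *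
          epow (shifted_max y (h k) x) (\<theta> * s) \<partial>count_space UNIV)"
      unfolding vector_shifted_max_def
    proof (intro nn_integral_mono)
      fix k :: int
      have "epow (shifted_max y (g k) x) s
        \<le> epow (2 * (epow (shifted_max y (h k) x) \<theta> * epow (shifted_max y F x) (1 - \<theta>))) s"
        using s by (intro epow_mono shifted_max_Hoelder \<theta> factor) auto
      also have "\<dots> = (ennreal (2 powr s) * epow (shifted_max y F x) ((1 - \<theta>) * s)) *
          epow (shifted_max y (h k) x) (\<theta> * s)"
        using epow_ennreal[of 2 s] by (simp add: epow_mult mult_ac)
      finally show "epow (shifted_max y (g k) x) s \<le> \<dots>" .
    qed
    also have "\<dots> = (ennreal (2 powr s) * epow (shifted_max y F x) ((1 - \<theta>) * s)) * S x"
      unfolding S_def vector_shifted_max_def by (rule nn_integral_cmult) simp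
    finally have "epow (vector_shifted_max y g s x) \<theta>
      \<le> epow ((ennreal (2 powr s) * epow (shifted_max y F x) ((1 - \<theta>) * s)) * S x) \<theta>"
      using \<theta> by (intro epow_mono) auto
    also have "\<dots> = ennreal (2 powr (s * \<theta>)) * (epow (S x) \<theta> * epow (epow (shifted_max y F x) (\<theta> * s)) (1 - \<theta>))"
      by (simp add: epow_mult epow_ennreal powr_powr mult_ac)
    finally show ?thesis .
  qed
  have "(\<integral>\<^sup>+x. epow (vector_shifted_max y g s x) \<theta> \<partial>lebesgue) \<le> ennreal (2 * 2 powr (s * \<theta>)) * (A * X)" if "X < top"
  proof -
    have "(\<integral>\<^sup>+x. epow (vector_shifted_max y g s x) \<theta> \<partial>lebesgue)
      \<le> (\<integral>\<^sup>+x. ennreal (2 powr (s * \<theta>)) * (epow (S x) \<theta> * epow (epow (shifted_max y F x) (\<theta> * s)) (1 - \<theta>)) \<partial>lebesgue)"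
      by (intro nn_integral_mono pointwise)
    also have "\<dots> = ennreal (2 powr (s * \<theta>)) * (\<integral>\<^sup>+x. epow (S x) \<theta> * epow (epow (shifted_max y F x) (\<theta> * s)) (1 - \<theta>) \<partial>lebesgue)"
      by (rule nn_integral_cmult) measurable
    also have "\<dots> \<le> ennreal (2 powr (s * \<theta>)) * (2 * (epow (\<integral>\<^sup>+x. S x \<partial>lebesgue) \<theta> *
        epow (\<integral>\<^sup>+x. epow (shifted_max y F x) (\<theta> * s) \<partial>lebesgue) (1 - \<theta>)))"
      using \<theta> by (intro mult_left_mono nn_integral_Hoelder) auto
    also have "\<dots> \<le> ennreal (2 powr (s * \<theta>)) * (2 * (epow (A * X) \<theta> * epow (A * X) (1 - \<theta>)))"
      using \<theta> by (intro mult_left_mono mult_mono epow_mono S_le A_le that) auto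
    also have "epow (A * X) \<theta> * epow (A * X) (1 - \<theta>) = A * X" by (simp flip: epow_add)
    also have "ennreal (2 powr (s * \<theta>)) * (2 * (A * X)) = ennreal (2 * 2 powr (s * \<theta>)) * (A * X)"
      by (simp add: ennreal_mult mult_ac)
    finally show ?thesis .
  qed
  \<comment> \<open>If \<open>X\<close> is infinite the right-hand side must be infinite too; this
    needs a nonzero factor, as 0 * top = 0.\<close>
  moreover have "A \<noteq> 0"
    unfolding A_def using weighted_const_pos[OF \<theta>(3), where 'n = 'n] shift_count_pos[where 'n = 'n] K
    by (simp add: ennreal_eq_0_iff mult_le_0_iff not_le)
  then have "(\<integral>\<^sup>+x. epow (vector_shifted_max y g s x) \<theta> \<partial>lebesgue) \<le> ennreal (2 * 2 powr (s * \<theta>)) * (A * X)"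
    if "X = top"
    using that by (simp add: ennreal_mult_top)
  ultimately show ?thesis unfolding A_def X_def G_def using less_top by blast
qed

text \<open>Duality: \<open>H\<^sup>\<rho> \<le> H w\<close> with \<open>w = H\<^sup>\<rho>\<^sup>-\<^sup>1\<close>, so the weighted inequality bounds the integral of
  \<open>H\<^sup>\<rho>\<close> by a fractional power of itself. Replacing \<open>H\<close> by a truncation makes it finite, so that
  this power can be cancelled.\<close>

lemma vector_shifted_max_bound_greater:
  fixes y :: "real ^ 'n" and g :: "int \<Rightarrow> real ^ 'n \<Rightarrow> ennreal"
  assumes K: "0 < K" and y: "\<And>i. \<bar>y $ i\<bar> + 1 \<le> 2 ^ K" and s: "1 < s" and \<rho>: "1 < \<rho>"
    and [measurable]: "\<And>k. g k \<in> borel_measurable lebesgue"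
  defines "c \<equiv> weighted_const TYPE('n) s * (real (shift_count TYPE('n)) *
    (2 * Lp_const TYPE('n) (\<rho> / (\<rho> - 1)) powr (1 - 1 / \<rho>)))"
  shows "(\<integral>\<^sup>+x. epow (vector_shifted_max y g s x) \<rho> \<partial>lebesgue)
    \<le> ennreal ((c * real K) powr \<rho>) *
       (\<integral>\<^sup>+x. epow (\<integral>\<^sup>+k. epow (g k x) s \<partial>count_space UNIV) \<rho> \<partial>lebesgue)"
proof -
  define G where "G x = (\<integral>\<^sup>+k. epow (g k x) s \<partial>count_space UNIV)" for x
  define X where "X = (\<integral>\<^sup>+x. epow (G x) \<rho> \<partial>lebesgue)"
  define H where "H = vector_shifted_max y g s"
  \<comment> \<open>Truncated in height and in space, so that the integral of its power \<rho> is
    finite.\<close>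
  define v where "v n x = min (H x) (of_nat n) * indicator (cball 0 (real n)) x" for n :: nat and x
  define u where "u = \<rho> / (\<rho> - 1)"
  define L where "L = Lp_const TYPE('n) u"
  have u: "1 < u" "1 / u = 1 - 1 / \<rho>" "(\<rho> - 1) * u = \<rho>"
    using \<rho> by (simp_all add: u_def field_simps)
  have L: "0 \<le> L" using strong_const_pos[OF u(1)] by (simp add: L_def Lp_const_def)
  have [measurable]: "G \<in> borel_measurable lebesgue" "H \<in> borel_measurable lebesgue"
    unfolding G_def[abs_def] H_def by measurable
  have [measurable]: "v n \<in> borel_measurable lebesgue" for n
  proof -
    have "cball (0 :: real ^ 'n) (real n) \<in> sets lebesgue" by simp
    then show ?thesis unfolding v_def[abs_def] by measurable
  qed
  have bound: "(\<integral>\<^sup>+x. epow (v n x) \<rho> \<partial>lebesgue) \<le> ennreal ((c * real K) powr \<rho>) * X" for n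
  proof -
    define I where "I = (\<integral>\<^sup>+x. epow (v n x) \<rho> \<partial>lebesgue)"
    define w where "w x = epow (v n x) (\<rho> - 1)" for x
    have [measurable]: "w \<in> borel_measurable lebesgue" unfolding w_def[abs_def] by measurable
    have "I \<le> (\<integral>\<^sup>+x. epow (of_nat n) \<rho> * indicator (cball 0 (real n)) (x :: real ^ 'n) \<partial>lebesgue)"
      unfolding I_def v_def using \<rho>
      by (intro nn_integral_mono) (auto simp: indicator_def intro!: epow_mono)
    also have "\<dots> < top"
      using emeasure_lborel_cball_finite[of "0 :: real ^ 'n" "real n"]
      by (auto simp: nn_integral_cmult_indicator ennreal_mult_less_top ennreal_mult_eq_top_iff less_top[symmetric])
    finally have I_fin: "I < top" .
    have w_u: "(\<integral>\<^sup>+x. epow (w x) u \<partial>lebesgue) = I"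
      using u by (simp add: I_def w_def)
    \<comment> \<open>Hoelder's inequality with \<rho> and its conjugate \<open>u\<close>, then the
      L^u bound for a single residue class, whose constant is free of \<open>K\<close>. Thus
      \<open>K\<close> enters only through the number of terms of the dual weight.\<close>
    have pair: "(\<integral>\<^sup>+x. G x * int_shifted_max (residue_class K k) d w x \<partial>lebesgue)
      \<le> 2 * (epow X (1 / \<rho>) * epow (ennreal L * I) (1 - 1 / \<rho>))"
      if d: "\<And>i. \<bar>d $ i\<bar> \<le> 2 ^ K" for k and d :: "int ^ 'n"
    proof -
      have "(\<integral>\<^sup>+x. G x * int_shifted_max (residue_class K k) d w x \<partial>lebesgue)
        = (\<integral>\<^sup>+x. epow (epow (G x) \<rho>) (1 / \<rho>) *
            epow (epow (int_shifted_max (residue_class K k) d w x) u) (1 - 1 / \<rho>) \<partial>lebesgue)"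
        using u(1) \<rho> unfolding u(2)[symmetric] by simp
      also have "\<dots> \<le> 2 * (epow X (1 / \<rho>) *
          epow (\<integral>\<^sup>+x. epow (int_shifted_max (residue_class K k) d w x) u \<partial>lebesgue) (1 - 1 / \<rho>))"
        unfolding X_def using \<rho> by (intro nn_integral_Hoelder) auto
      also have "\<dots> \<le> 2 * (epow X (1 / \<rho>) * epow (ennreal L * I) (1 - 1 / \<rho>))"
        using strong_type_unweighted[OF lacunary_residue_class d u(1), of w] \<rho>
        unfolding w_u L_def by (intro mult_left_mono epow_mono) auto
      finally show ?thesis .
    qed
    have "I \<le> (\<integral>\<^sup>+x. H x * w x \<partial>lebesgue)"
      unfolding I_def
    proof (intro nn_integral_mono)
      fix x
      have "epow (v n x) \<rho> = v n x * w x"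
        unfolding w_def using epow_add[of "v n x" 1 "\<rho> - 1"] by simp
      also have "v n x \<le> H x" unfolding v_def by (auto simp: indicator_def)
      finally show "epow (v n x) \<rho> \<le> H x * w x" by (simp add: mult_right_mono)
    qed
    also have "\<dots> = (\<integral>\<^sup>+k. (\<integral>\<^sup>+x. epow (shifted_max y (g k) x) s * w x \<partial>lebesgue) \<partial>count_space UNIV)"
      unfolding H_def vector_shifted_max_def
      by (subst nn_integral_count_space_nn_integral[symmetric]) (auto simp: nn_integral_multc)
    also have "\<dots> \<le> (\<integral>\<^sup>+k. ennreal (weighted_const TYPE('n) s) *
        (\<integral>\<^sup>+x. epow (g k x) s * dual_weight y K w x \<partial>lebesgue) \<partial>count_space UNIV)"
      by (intro nn_integral_mono shifted_max_weighted K y s) auto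
    also have "\<dots> = ennreal (weighted_const TYPE('n) s) *
        (\<integral>\<^sup>+k. (\<integral>\<^sup>+x. epow (g k x) s * dual_weight y K w x \<partial>lebesgue) \<partial>count_space UNIV)"
      by (rule nn_integral_cmult) simp
    also have "(\<integral>\<^sup>+k. (\<integral>\<^sup>+x. epow (g k x) s * dual_weight y K w x \<partial>lebesgue) \<partial>count_space UNIV)
      = (\<integral>\<^sup>+x. G x * dual_weight y K w x \<partial>lebesgue)"
      unfolding G_def
      by (subst nn_integral_count_space_nn_integral[symmetric]) (auto simp: nn_integral_multc)
    also have "(\<integral>\<^sup>+x. G x * dual_weight y K w x \<partial>lebesgue)
      = (\<Sum>e\<in>corner_shifts. \<Sum>k\<in>{0..<int K}. \<Sum>d\<in>dual_shifts (vfloor y + e).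
          \<integral>\<^sup>+x. G x * int_shifted_max (residue_class K k) d w x \<partial>lebesgue)"
      by (simp add: dual_weight_def sum_distrib_left nn_integral_sum)
    also have "\<dots> \<le> ennreal (real (shift_count TYPE('n) * K)) *
        (2 * (epow X (1 / \<rho>) * epow (ennreal L * I) (1 - 1 / \<rho>)))"
      by (intro sum_dual_shifts_le y pair) auto
    finally have "I \<le> ennreal (weighted_const TYPE('n) s) * (ennreal (real (shift_count TYPE('n) * K)) *
        (2 * (epow X (1 / \<rho>) * epow (ennreal L * I) (1 - 1 / \<rho>))))"
      by (simp add: mult_left_mono)
    also have "\<dots> = (ennreal (c * real K) * epow X (1 / \<rho>)) * epow I (1 - 1 / \<rho>)"
    proof -
      have "ennreal (c * real K) = ennreal (weighted_const TYPE('n) s) *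
          (ennreal (real (shift_count TYPE('n) * K)) * (2 * ennreal (L powr (1 - 1 / \<rho>))))"
        using weighted_const_pos[OF s, where 'n = 'n]
        by (simp add: c_def L_def u_def ennreal_mult mult_ac)
      then show ?thesis using L by (simp add: epow_mult epow_ennreal mult_ac)
    qed
    finally have I_le: "I \<le> (ennreal (c * real K) * epow X (1 / \<rho>)) * epow I (1 - 1 / \<rho>)" .
    \<comment> \<open>For 0 < I < top the factor \<open>I\<close>^(1-1/\<rho>) can be cancelled on
      both sides.\<close>
    have "epow I (1 / \<rho>) \<le> ennreal (c * real K) * epow X (1 / \<rho>)"
    proof (cases "I = 0")
      case False
      have "epow I (1 / \<rho>) * epow I (1 - 1 / \<rho>) = I" by (simp flip: epow_add)
      then have "epow I (1 - 1 / \<rho>) * epow I (1 / \<rho>)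
        \<le> epow I (1 - 1 / \<rho>) * (ennreal (c * real K) * epow X (1 / \<rho>))"
        using I_le by (simp add: mult_ac)
      then show ?thesis
        using False I_fin by (subst (asm) ennreal_mult_le_mult_iff) auto
    qed simp
    then have "I \<le> epow (ennreal (c * real K) * epow X (1 / \<rho>)) \<rho>"
      using \<rho> by (subst (asm) epow_le_iff) auto
    also have "\<dots> = ennreal ((c * real K) powr \<rho>) * X"
      using \<rho> weighted_const_pos[OF s, where 'n = 'n] by (simp add: epow_mult epow_ennreal c_def)
    finally show ?thesis unfolding I_def .
  qed
  have "incseq v"
    unfolding v_def incseq_def le_fun_def
    by (auto simp: indicator_def intro: min.coboundedI2)
  \<comment> \<open>Comparison with each \<open>a\<close> below \<open>H x\<close> covers infinite
    values too: such an \<open>a\<close> is finite and below some truncation height, and a large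
    ball contains \<open>x\<close>.\<close>
  have H_le: "H x \<le> (SUP n. v n x)" for x
  proof (rule dense_le)
    fix a assume a: "a < H x"
    then have "a < top" by (rule order_less_le_trans) simp
    then obtain n where n: "a < of_nat n" using ennreal_Ex_less_of_nat by blast
    define N where "N = max n (nat \<lceil>norm x\<rceil>)"
    have "norm x \<le> real N"
      using real_nat_ceiling_ge[of "norm x"] unfolding N_def by (simp add: of_nat_max le_max_iff_disj)
    moreover have "a < of_nat N" using n by (rule order_less_le_trans) (simp add: N_def)
    ultimately have "a \<le> v N x" using a by (simp add: v_def less_imp_le)
    then show "a \<le> (SUP n. v n x)" by (rule SUP_upper2[rotated]) simp
  qed
  have "(\<integral>\<^sup>+x. epow (H x) \<rho> \<partial>lebesgue) \<le> (\<integral>\<^sup>+x. (SUP n. epow (v n x) \<rho>) \<partial>lebesgue)"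
    using \<rho> by (intro nn_integral_mono) (simp add: epow_mono H_le flip: epow_SUP)
  also have "\<dots> = (SUP n. \<integral>\<^sup>+x. epow (v n x) \<rho> \<partial>lebesgue)"
  proof (rule nn_integral_monotone_convergence_SUP)
    show "incseq (\<lambda>n x. epow (v n x) \<rho>)"
      using \<open>incseq v\<close> \<rho> by (auto simp: incseq_def le_fun_def intro!: epow_mono)
  qed simp
  also have "\<dots> \<le> ennreal ((c * real K) powr \<rho>) * X"
    by (intro SUP_least bound)
  finally show ?thesis unfolding H_def X_def G_def .
qed

text \<open>Since 2^K >= e + |y|, shifts are within the bound 2^K. As ln 2 >= 1/2, the binary
  logarithm is at most twice the natural one, and the rounding error 1 is absorbed by ln(e + |y|) >=
  1, giving 2 + 1 = 3.\<close>

lemma log_scale_count: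
  fixes y :: "real ^ 'n"
  defines "K \<equiv> nat \<lceil>log 2 (exp 1 + norm y)\<rceil>"
  shows "0 < K" "\<bar>y $ i\<bar> + 1 \<le> 2 ^ K" "real K \<le> 3 * ln (exp 1 + norm y)" "1 \<le> ln (exp 1 + norm y)"
proof -
  have e: "2 \<le> exp 1 + norm y" using exp_ge_add_one_self[of 1] by (intro add_increasing2) auto
  show 1: "1 \<le> ln (exp 1 + norm y)" using e by (subst ln_ge_iff) auto
  have log: "1 \<le> log 2 (exp 1 + norm y)" using e by simp
  have K: "log 2 (exp 1 + norm y) \<le> real K" "real K \<le> log 2 (exp 1 + norm y) + 1"
    using log unfolding K_def by linarith+
  show "0 < K" using log K by linarith
  have "exp 1 + norm y \<le> 2 powr real K" using K(1) e by (simp add: log_le_iff)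
  then have "exp 1 + norm y \<le> 2 ^ K" by (simp add: powr_realpow)
  then show "\<bar>y $ i\<bar> + 1 \<le> 2 ^ K"
    using component_le_norm_cart[of y i] exp_ge_add_one_self[of 1] by linarith
  have "log 2 (exp 1 + norm y) \<le> 2 * ln (exp 1 + norm y)"
    using ln2_ge_two_thirds 1 mult_mono[of 1 "2 * ln 2" "ln (exp 1 + norm y)" "ln (exp 1 + norm y)"]
    by (simp add: log_def divide_simps)
  then show "real K \<le> 3 * ln (exp 1 + norm y)" using K 1 by linarith
qed

text \<open>Here \<rho> stands for p/q and \<open>s\<close> for q/t. The loss is \<open>K\<close>
  for \<rho> <= 1 and K^\<rho> for \<rho> > 1, which after the p-th root becomes the larger of the
  exponents 1/p and 1/q.\<close>

lemma vector_shifted_max_bound: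
  assumes s: "1 < s" and \<rho>: "0 < \<rho>" "1 < \<rho> * s"
  shows "\<exists>C>0. \<forall>(y :: real ^ 'n) (g :: int \<Rightarrow> real ^ 'n \<Rightarrow> ennreal).
    (\<forall>k. g k \<in> borel_measurable lebesgue) \<longrightarrow>
    (\<integral>\<^sup>+x. epow (vector_shifted_max y g s x) \<rho> \<partial>lebesgue)
      \<le> ennreal (C * ln (exp 1 + norm y) powr max 1 \<rho>) *
        (\<integral>\<^sup>+x. epow (\<integral>\<^sup>+k. epow (g k x) s \<partial>count_space UNIV) \<rho> \<partial>lebesgue)"
proof -
  let ?L = "\<lambda>y :: real ^ 'n. ln (exp 1 + norm y)"
  let ?R = "\<lambda>g :: int \<Rightarrow> real ^ 'n \<Rightarrow> ennreal.
    \<integral>\<^sup>+x. epow (\<integral>\<^sup>+k. epow (g k x) s \<partial>count_space UNIV) \<rho> \<partial>lebesgue"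
  have raise: "ennreal (b * real (nat \<lceil>log 2 (exp 1 + norm y)\<rceil>)) \<le> ennreal (b * 3 * ?L y)"
    if "0 \<le> b" for b and y :: "real ^ 'n"
    using mult_left_mono[OF log_scale_count(3) that, of y] by (intro ennreal_leI) (simp add: mult_ac)
  consider "\<rho> < 1" | "\<rho> = 1" | "1 < \<rho>" by linarith
  then show ?thesis
  proof cases
    case 1
    define A where "A = weighted_const TYPE('n) (\<rho> * s) * real (shift_count TYPE('n))"
    have A: "0 < A" using weighted_const_pos[OF \<rho>(2), where 'n = 'n] shift_count_pos[where 'n = 'n]
      by (simp add: A_def)
    show ?thesis
    proof (intro exI[of _ "2 * 2 powr (s * \<rho>) * (A * 3)"] conjI allI impI)
      fix y :: "real ^ 'n" and g :: "int \<Rightarrow> real ^ 'n \<Rightarrow> ennreal"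
      assume g: "\<forall>k. g k \<in> borel_measurable lebesgue"
      define K where "K = nat \<lceil>log 2 (exp 1 + norm y)\<rceil>"
      have "(\<integral>\<^sup>+x. epow (vector_shifted_max y g s x) \<rho> \<partial>lebesgue)
        \<le> ennreal (2 * 2 powr (s * \<rho>)) * (ennreal (A * real K) * ?R g)"
        using vector_shifted_max_bound_less[of K y s \<rho> g] log_scale_count(1,2)[of y] s \<rho> 1 g
        by (simp add: K_def A_def mult_ac)
      also have "\<dots> \<le> ennreal (2 * 2 powr (s * \<rho>)) * (ennreal (A * 3 * ?L y) * ?R g)"
        using A raise[of A y] unfolding K_def by (intro mult_left_mono mult_right_mono) auto
      also have "\<dots> = ennreal (2 * 2 powr (s * \<rho>) * (A * 3) * ?L y powr max 1 \<rho>) * ?R g"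
        using A 1 log_scale_count(4)[of y] by (simp add: ennreal_mult max_def mult_ac)
      finally show "(\<integral>\<^sup>+x. epow (vector_shifted_max y g s x) \<rho> \<partial>lebesgue) \<le> \<dots>" .
    qed (use A in simp)
  next
    case 2
    define A where "A = weighted_const TYPE('n) s * real (shift_count TYPE('n))"
    have A: "0 < A" using weighted_const_pos[OF s, where 'n = 'n] shift_count_pos[where 'n = 'n]
      by (simp add: A_def)
    show ?thesis
    proof (intro exI[of _ "A * 3"] conjI allI impI)
      fix y :: "real ^ 'n" and g :: "int \<Rightarrow> real ^ 'n \<Rightarrow> ennreal"
      assume g: "\<forall>k. g k \<in> borel_measurable lebesgue"
      define K where "K = nat \<lceil>log 2 (exp 1 + norm y)\<rceil>"
      have "(\<integral>\<^sup>+x. epow (vector_shifted_max y g s x) \<rho> \<partial>lebesgue) \<le> ennreal (A * real K) * ?R g"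
        using vector_shifted_max_bound_eq[of K y s g] log_scale_count(1,2)[of y] s 2 g
        by (simp add: K_def A_def mult_ac)
      also have "\<dots> \<le> ennreal (A * 3 * ?L y) * ?R g"
        using A raise[of A y] unfolding K_def by (intro mult_right_mono) auto
      also have "\<dots> = ennreal (A * 3 * ?L y powr max 1 \<rho>) * ?R g"
        using 2 log_scale_count(4)[of y] by simp
      finally show "(\<integral>\<^sup>+x. epow (vector_shifted_max y g s x) \<rho> \<partial>lebesgue) \<le> \<dots>" .
    qed (use A in simp)
  next
    case 3
    define c where "c = weighted_const TYPE('n) s * (real (shift_count TYPE('n)) *
      (2 * Lp_const TYPE('n) (\<rho> / (\<rho> - 1)) powr (1 - 1 / \<rho>)))"
    have "0 < Lp_const TYPE('n) (\<rho> / (\<rho> - 1))"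
      using strong_const_pos[of "\<rho> / (\<rho> - 1)"] 3 by (simp add: Lp_const_def)
    then have c: "0 < c"
      using weighted_const_pos[OF s, where 'n = 'n] shift_count_pos[where 'n = 'n]
      by (simp add: c_def)
    show ?thesis
    proof (intro exI[of _ "(c * 3) powr \<rho>"] conjI allI impI)
      fix y :: "real ^ 'n" and g :: "int \<Rightarrow> real ^ 'n \<Rightarrow> ennreal"
      assume g: "\<forall>k. g k \<in> borel_measurable lebesgue"
      define K where "K = nat \<lceil>log 2 (exp 1 + norm y)\<rceil>"
      have "(\<integral>\<^sup>+x. epow (vector_shifted_max y g s x) \<rho> \<partial>lebesgue) \<le> ennreal ((c * real K) powr \<rho>) * ?R g"
        unfolding c_def using log_scale_count(1,2)[of y] g
        by (intro vector_shifted_max_bound_greater 3 s) (auto simp: K_def)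
      also have "\<dots> \<le> ennreal ((c * 3 * ?L y) powr \<rho>) * ?R g"
        using c 3 log_scale_count(3)[of y]
        by (intro mult_right_mono ennreal_leI powr_mono2) (auto simp: K_def)
      also have "\<dots> = ennreal ((c * 3) powr \<rho> * ?L y powr max 1 \<rho>) * ?R g"
        using c 3 log_scale_count(4)[of y] by (simp add: powr_mult max_def)
      finally show "(\<integral>\<^sup>+x. epow (vector_shifted_max y g s x) \<rho> \<partial>lebesgue) \<le> \<dots>" .
    qed (use c in simp)
  qed
qed

text \<open>The case of infinite q: every \<open>shifted_max y (g k)\<close> is dominated by the
  maximal function of the pointwise supremum, to which the scalar bound applies.\<close>

lemma shifted_max_SUP_bound:
  assumes r: "1 < r"
  shows "\<exists>C>0. \<forall>(y :: real ^ 'n) (g :: int \<Rightarrow> real ^ 'n \<Rightarrow> ennreal).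
    (\<forall>k. g k \<in> borel_measurable lebesgue) \<longrightarrow>
    (\<integral>\<^sup>+x. epow (SUP k. shifted_max y (g k) x) r \<partial>lebesgue)
      \<le> ennreal (C * ln (exp 1 + norm y)) * (\<integral>\<^sup>+x. epow (SUP k. g k x) r \<partial>lebesgue)"
proof -
  define A where "A = weighted_const TYPE('n) r * real (shift_count TYPE('n))"
  have A: "0 < A" using weighted_const_pos[OF r, where 'n = 'n] shift_count_pos[where 'n = 'n]
    by (simp add: A_def)
  show ?thesis
  proof (intro exI[of _ "A * 3"] conjI allI impI)
    fix y :: "real ^ 'n" and g :: "int \<Rightarrow> real ^ 'n \<Rightarrow> ennreal"
    assume g: "\<forall>k. g k \<in> borel_measurable lebesgue"
    define K where "K = nat \<lceil>log 2 (exp 1 + norm y)\<rceil>"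
    let ?F = "\<lambda>x. SUP k. g k x"
    have F: "?F \<in> borel_measurable lebesgue" using g by (intro borel_measurable_SUP) auto
    have "(\<integral>\<^sup>+x. epow (SUP k. shifted_max y (g k) x) r \<partial>lebesgue)
      \<le> (\<integral>\<^sup>+x. epow (shifted_max y ?F x) r \<partial>lebesgue)"
      using r by (intro nn_integral_mono epow_mono SUP_least shifted_max_mono SUP_upper) auto
    also have "\<dots> \<le> ennreal (A * real K) * (\<integral>\<^sup>+x. epow (?F x) r \<partial>lebesgue)"
      using shifted_max_Lp[of K y r ?F] log_scale_count(1,2)[of y] r F
      by (simp add: K_def A_def mult_ac)
    also have "\<dots> \<le> ennreal (A * 3 * ln (exp 1 + norm y)) * (\<integral>\<^sup>+x. epow (?F x) r \<partial>lebesgue)"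
      using A log_scale_count(3)[of y]
      by (intro mult_right_mono ennreal_leI) (auto simp: K_def mult.assoc)
    finally show "(\<integral>\<^sup>+x. epow (SUP k. shifted_max y (g k) x) r \<partial>lebesgue) \<le> \<dots>" .
  qed (use A in simp)
qed

section \<open>From counting-measure integrals to the mixed norms of the theorem\<close>

lemma SUP_finite_sum_int:
  "(SUP S\<in>{S. finite S}. \<Sum>k\<in>S. f k) = (\<integral>\<^sup>+k. f k \<partial>count_space (UNIV :: int set))"
proof (rule antisym)
  show "(SUP S\<in>{S. finite S}. \<Sum>k\<in>S. f k) \<le> (\<integral>\<^sup>+k. f k \<partial>count_space UNIV)"
  proof (rule SUP_least)
    fix S :: "int set" assume "S \<in> {S. finite S}"
    then have "(\<Sum>k\<in>S. f k) = (\<integral>\<^sup>+k. f k * indicator S k \<partial>count_space UNIV)"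
      by (simp add: nn_integral_count_space_finite flip: nn_integral_count_space_indicator)
    also have "\<dots> \<le> (\<integral>\<^sup>+k. f k \<partial>count_space UNIV)"
      by (intro nn_integral_mono) (simp add: indicator_def)
    finally show "(\<Sum>k\<in>S. f k) \<le> (\<integral>\<^sup>+k. f k \<partial>count_space UNIV)" .
  qed
  have "(\<integral>\<^sup>+k. f k \<partial>count_space UNIV) = (\<Sum>n. f (int_decode n))"
    using nn_integral_bij_count_space[OF bij_int_decode, of f] by (simp add: nn_integral_count_space_nat)
  also have "\<dots> = (SUP n. \<Sum>i<n. f (int_decode i))" by (rule suminf_eq_SUP)
  also have "\<dots> \<le> (SUP S\<in>{S. finite S}. \<Sum>k\<in>S. f k)"
  proof (rule SUP_least)
    fix n
    have "(\<Sum>i<n. f (int_decode i)) = (\<Sum>k\<in>int_decode ` {..<n}. f k)"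
      by (simp add: sum.reindex inj_int_decode)
    also have "\<dots> \<le> (SUP S\<in>{S. finite S}. \<Sum>k\<in>S. f k)" by (rule SUP_upper) simp
    finally show "(\<Sum>i<n. f (int_decode i)) \<le> (SUP S\<in>{S. finite S}. \<Sum>k\<in>S. f k)" .
  qed
  finally show "(\<integral>\<^sup>+k. f k \<partial>count_space UNIV) \<le> (SUP S\<in>{S. finite S}. \<Sum>k\<in>S. f k)" .
qed

text \<open>The restrictions to growing balls are integrable, and at each point they are eventually
  equal to \<open>f\<close>.\<close>

lemma locally_integrable_measurable:
  fixes f :: "real ^ 'n \<Rightarrow> real"
  assumes "locally_integrable f"
  shows "f \<in> borel_measurable lebesgue"
proof (rule borel_measurable_LIMSEQ_real)
  fix n :: nat
  show "(\<lambda>x. indicator (cball 0 (real n)) x *\<^sub>R f x) \<in> borel_measurable lebesgue"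
    using assms compact_cball unfolding locally_integrable_def set_integrable_def
    by (intro borel_measurable_integrable) blast
next
  fix x :: "real ^ 'n"
  have "eventually (\<lambda>n. indicator (cball 0 (real n)) x *\<^sub>R f x = f x) sequentially"
    using eventually_ge_at_top[of "nat \<lceil>norm x\<rceil>"]
  proof eventually_elim
    case (elim n)
    then have "norm x \<le> real n" by linarith
    then show ?case by simp
  qed
  then show "(\<lambda>n. indicator (cball 0 (real n)) x *\<^sub>R f x) \<longlonglongrightarrow> f x"
    by (rule tendsto_eventually)
qed

theorem theorem1p4:
  fixes p t \<tau> :: real and q :: ereal
  assumes "0 < p" and "0 < q"
    and "0 < t" and "t < p" and "ereal t < q"
    and "ereal p \<le> q \<Longrightarrow> \<tau> = 1 / p"
    and "q < ereal p \<Longrightarrow> \<tau> > 1 / real_of_ereal q"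
  shows "\<exists>C :: real. \<forall>(y :: real ^ 'n) (f :: int \<Rightarrow> real ^ 'n \<Rightarrow> real).
           (\<forall>k. locally_integrable (f k)) \<longrightarrow>
           LpLq_norm p q (\<lambda>k. shifted_max_t y t (f k))
             \<le> ennreal (C * ln (exp 1 + norm y) powr \<tau>) *
                LpLq_norm p q (\<lambda>k x. ennreal \<bar>f k x\<bar>)"
proof (cases "q = \<infinity>")
  case True
  have "1 < p / t" using assms by simp
  from shifted_max_SUP_bound[OF this, where 'n = 'n]
  obtain C where C: "0 < C" and bound: "\<And>(y :: real ^ 'n) (g :: int \<Rightarrow> real ^ 'n \<Rightarrow> ennreal).
    (\<And>k. g k \<in> borel_measurable lebesgue) \<Longrightarrow>
    (\<integral>\<^sup>+x. epow (SUP k. shifted_max y (g k) x) (p / t) \<partial>lebesgue)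
      \<le> ennreal (C * ln (exp 1 + norm y)) * (\<integral>\<^sup>+x. epow (SUP k. g k x) (p / t) \<partial>lebesgue)"
    by blast
  show ?thesis
  proof (intro exI[of _ "C powr (1 / p)"] allI impI)
    fix y :: "real ^ 'n" and f :: "int \<Rightarrow> real ^ 'n \<Rightarrow> real"
    assume "\<forall>k. locally_integrable (f k)"
    then have [measurable]: "f k \<in> borel_measurable lebesgue" for k
      using locally_integrable_measurable by blast
    define g where "g k x = ennreal (\<bar>f k x\<bar> powr t)" for k x
    have [measurable]: "g k \<in> borel_measurable lebesgue" for k
      unfolding g_def[abs_def] by measurable
    have f_eq: "ennreal \<bar>f k x\<bar> = epow (g k x) (1 / t)" for k x
      using assms(3) by (simp add: g_def epow_ennreal powr_powr)
    \<comment> \<open>The root 1/t inside the supremum commutes with it and combines with the outer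
      power to p/t.\<close>
    have "LpLq_norm p q (\<lambda>k. shifted_max_t y t (f k))
      = epow (\<integral>\<^sup>+x. epow (SUP k. shifted_max y (g k) x) (p / t) \<partial>lebesgue) (1 / p)"
      using assms(3) True
      by (simp add: LpLq_norm_def lq_pt_def shifted_max_t_def g_def[abs_def] flip: epow_SUP)
    also have "\<dots> \<le> epow (ennreal (C * ln (exp 1 + norm y)) * (\<integral>\<^sup>+x. epow (SUP k. g k x) (p / t) \<partial>lebesgue)) (1 / p)"
      using assms(1) by (intro epow_mono bound) auto
    also have "\<dots> = ennreal (C powr (1 / p) * ln (exp 1 + norm y) powr \<tau>) *
        LpLq_norm p q (\<lambda>k x. ennreal \<bar>f k x\<bar>)"
      using assms True C log_scale_count(4)[of y]
      by (simp add: LpLq_norm_def lq_pt_def f_eq epow_mult epow_ennreal powr_mult flip: epow_SUP)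
    finally show "LpLq_norm p q (\<lambda>k. shifted_max_t y t (f k)) \<le> \<dots>" .
  qed
next
  case False
  then obtain q' where q: "q = ereal q'" using assms(2) by (cases q) auto
  have q': "0 < q'" "t < q'" using assms q by auto
  have "1 < q' / t" "0 < p / q'" "1 < p / q' * (q' / t)" using assms q' by simp_all
  from vector_shifted_max_bound[OF this, where 'n = 'n]
  obtain C where C: "0 < C" and bound: "\<And>(y :: real ^ 'n) (g :: int \<Rightarrow> real ^ 'n \<Rightarrow> ennreal).
    (\<And>k. g k \<in> borel_measurable lebesgue) \<Longrightarrow>
    (\<integral>\<^sup>+x. epow (vector_shifted_max y g (q' / t) x) (p / q') \<partial>lebesgue)
      \<le> ennreal (C * ln (exp 1 + norm y) powr max 1 (p / q')) *
        (\<integral>\<^sup>+x. epow (\<integral>\<^sup>+k. epow (g k x) (q' / t) \<partial>count_space UNIV) (p / q') \<partial>lebesgue)"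
    by blast
  \<comment> \<open>The left side is 1/p for p <= q and 1/q for q < p. Raising it to
    \<open>\<tau>\<close> is harmless because the logarithm is at least 1.\<close>
  have \<tau>: "max 1 (p / q') * (1 / p) \<le> \<tau>"
    using assms(1,6,7) q q' by (cases "p \<le> q'") (auto simp: max_def field_simps)
  show ?thesis
  proof (intro exI[of _ "C powr (1 / p)"] allI impI)
    fix y :: "real ^ 'n" and f :: "int \<Rightarrow> real ^ 'n \<Rightarrow> real"
    assume "\<forall>k. locally_integrable (f k)"
    then have [measurable]: "f k \<in> borel_measurable lebesgue" for k
      using locally_integrable_measurable by blast
    define g where "g k x = ennreal (\<bar>f k x\<bar> powr t)" for k x
    define L where "L = ln (exp 1 + norm y)"
    have L: "1 \<le> L" unfolding L_def by (rule log_scale_count(4))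
    have [measurable]: "g k \<in> borel_measurable lebesgue" for k
      unfolding g_def[abs_def] by measurable
    have f_eq: "ennreal \<bar>f k x\<bar> = epow (g k x) (1 / t)" for k x
      using assms(3) by (simp add: g_def epow_ennreal powr_powr)
    \<comment> \<open>The inner powers 1/t and q' combine to q'/t, the outer powers 1/q' and p to
      p/q'.\<close>
    have "LpLq_norm p q (\<lambda>k. shifted_max_t y t (f k))
      = epow (\<integral>\<^sup>+x. epow (vector_shifted_max y g (q' / t) x) (p / q') \<partial>lebesgue) (1 / p)"
      by (simp add: LpLq_norm_def lq_pt_def q shifted_max_t_def SUP_finite_sum_int
          vector_shifted_max_def g_def[abs_def])
    also have "\<dots> \<le> epow (ennreal (C * L powr max 1 (p / q')) *
        (\<integral>\<^sup>+x. epow (\<integral>\<^sup>+k. epow (g k x) (q' / t) \<partial>count_space UNIV) (p / q') \<partial>lebesgue)) (1 / p)"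
      using assms(1) unfolding L_def by (intro epow_mono bound) auto
    also have "\<dots> = ennreal (C powr (1 / p) * L powr (max 1 (p / q') * (1 / p))) *
        LpLq_norm p q (\<lambda>k x. ennreal \<bar>f k x\<bar>)"
      using C L
      by (simp add: LpLq_norm_def lq_pt_def q f_eq SUP_finite_sum_int epow_mult epow_ennreal
          powr_mult powr_powr)
    also have "\<dots> \<le> ennreal (C powr (1 / p) * L powr \<tau>) * LpLq_norm p q (\<lambda>k x. ennreal \<bar>f k x\<bar>)"
      using \<tau> L by (intro mult_right_mono ennreal_leI mult_left_mono powr_mono) auto
    finally show "LpLq_norm p q (\<lambda>k. shifted_max_t y t (f k))
      \<le> ennreal (C powr (1 / p) * ln (exp 1 + norm y) powr \<tau>) * LpLq_norm p q (\<lambda>k x. ennreal \<bar>f k x\<bar>)"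
      unfolding L_def .
  qed
qed

end
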